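(* Let $\bm{A}\in\mathbb{Z}^{n\times n}$ be a nonsingular matrix and $C(\bm{A})=\{\bm{x}\in\mathbb{R}^n:\bm{A}\bm{x}\ge\bm{0}\}$. (i) If $1\le\Delta(\bm{A})\le 4$, then $\operatorname{CR}(C(\bm{A}))=n$. (ii) If $\Delta(\bm{A})\ge 5$, then $\operatorname{CR}(C(\bm{A}))\le n+\Delta(\bm{A})-3$.
   Context: For $\bm{A}\in\mathbb{Z}^{n\times n}$ nonsingular, $\Delta(\bm{A})=|\det\bm{A}|$ (the maximal absolute $n\times n$ minor). For a rational pointed cone $C$, the semigroup $C\cap\mathbb{Z}^n$ has a unique inclusion-minimal finite generating set $H(C)$ (every integer point of $C$ is a non-negative integer combination of its elements), the Hilbert basis. For $\bm{x}\in C\cap\mathbb{Z}^n$, $\sigma(\bm{x})=\min\{l:\bm{x}=\lambda_1\bm{h}_1+\cdots+\lambda_l\bm{h}_l,\ \lambda_i\in\mathbb{Z}_{\ge0},\ \bm{h}_i\in H(C)\}$, and the integer Carathéodory rank is $\operatorname{CR}(C)=\max\{\sigma(\bm{x}):\bm{x}\in C\cap\mathbb{Z}^n\}$. *)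

theory Defs
  imports "HOL-Analysis.Analysis"
begin

definition matrix_cone :: "int^'n^'n \<Rightarrow> (real^'n) set" where
  "matrix_cone A = {x. \<forall>i. 0 \<le> ((\<chi> i j. real_of_int (A $ i $ j)) *v x) $ i}"

text \<open>For a square matrix the only full-size minor is the determinant.\<close>

definition Delta :: "int^'n^'n \<Rightarrow> int" where
  "Delta A = \<bar>det A\<bar>"

definition integer_points :: "(real^'n) set" where
  "integer_points = {x. \<forall>i. x $ i \<in> \<int>}"

definition finite_generating_set :: "(real^'n) set \<Rightarrow> (real^'n) set \<Rightarrow> bool" where
  "finite_generating_set C H \<longleftrightarrow>
     finite H \<and> H \<subseteq> C \<inter> integer_points \<and>
     (\<forall>x \<in> C \<inter> integer_points. \<exists>c :: real^'n \<Rightarrow> nat. x = (\<Sum>h\<in>H. real (c h) *\<^sub>R h))"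

text \<open>The description below determines a set uniquely when \<open>C\<close> is a rational pointed cone;
  for other \<open>C\<close> the value may be unspecified.\<close>

definition hilbert_basis :: "(real^'n) set \<Rightarrow> (real^'n) set" where
  "hilbert_basis C =
     (THE H. finite_generating_set C H \<and>
             (\<forall>H'. finite_generating_set C H' \<and> H' \<subseteq> H \<longrightarrow> H' = H))"

text \<open>The \<open>h i\<close> need not be distinct and the \<open>c i\<close> may vanish; neither affects the minimum.
  The empty sum gives the origin length \<open>0\<close>.\<close>

definition carath_length :: "(real^'n) set \<Rightarrow> real^'n \<Rightarrow> nat" where
  "carath_length C x =
     (LEAST l. \<exists>(h :: nat \<Rightarrow> real^'n) (c :: nat \<Rightarrow> nat).
        (\<forall>i<l. h i \<in> hilbert_basis C) \<and> x = (\<Sum>i<l. real (c i) *\<^sub>R h i))"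

text \<open>The maximum is over a finite set for rational pointed \<open>C\<close>, as all lengths are at most
  the cardinality of the Hilbert basis.\<close>

definition carath_rank :: "(real^'n) set \<Rightarrow> nat" where
  "carath_rank C = Max (carath_length C ` (C \<inter> integer_points))"

end

theory Submission
  imports Defs "HOL-Computational_Algebra.Polynomial"
begin

text \<open>In the coordinates given by the facet slacks \<open>(A x)\<^sub>i\<close> the lattice points of the cone are the
  vectors \<open>y\<close> of natural numbers with \<open>\<Sum> y\<^sub>i g\<^sub>i = 0\<close>, where \<open>g\<^sub>i\<close> is the class of the \<open>i\<close>-th unit vector
  in the group \<open>G\<close> of order \<open>\<Delta>\<close> given by the integer vectors modulo the column lattice of \<open>A\<close>. If some nonempty
  family of the \<open>g\<^sub>i\<close> sums to zero (for instance a single \<open>g\<^sub>i = 0\<close>), a multiple of one atom clears a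
  coordinate; if \<open>g\<^sub>i = g\<^sub>j\<close>, the two coordinates can be merged at the price of one more atom. In
  either case the dimension \<open>k\<close> and the bound drop by one. Otherwise the \<open>g\<^sub>i\<close> are distinct and nonzero, so
  \<open>k < \<Delta>\<close>, and Sebo's bound \<open>2 k - 2\<close> suffices, except for \<open>k = 3\<close> and \<open>\<Delta> = 4\<close>, where a zero-sum
  family exists by pigeonhole.

  The lower bound holds since the lattice points of the cone are not covered by finitely many
  hyperplanes.\<close>

section \<open>Integer matrices and congruence modulo their column lattice\<close>

definition real_vec :: "int^'n \<Rightarrow> real^'n" where
  "real_vec v = (\<chi> i. real_of_int (v $ i))"

definition real_mat :: "int^'n^'n \<Rightarrow> real^'n^'n" where
  "real_mat A = (\<chi> i j. real_of_int (A $ i $ j))"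

lemma real_vec_nth [simp]: "real_vec v $ i = real_of_int (v $ i)"
  by (simp add: real_vec_def)

lemma real_vec_inject [simp]: "real_vec u = real_vec v \<longleftrightarrow> u = v"
  by (simp add: vec_eq_iff)

lemma real_mat_mult_vec: "real_mat A *v real_vec v = real_vec (A *v v)"
  by (simp add: vec_eq_iff matrix_vector_mult_def real_mat_def)

lemma det_real_mat: "det (real_mat A) = real_of_int (det A)"
  by (simp add: det_def real_mat_def)

lemma matrix_vector_mult_smult:
  fixes A :: "int^'m^'n"
  shows "A *v (c *s x) = c *s (A *v x)"
  by (simp add: vec_eq_iff matrix_vector_mult_def sum_distrib_left mult_ac)

lemma mult_vec_eq_0_iff:
  fixes A :: "int^'n^'n"
  assumes "det A \<noteq> 0"
  shows "A *v x = 0 \<longleftrightarrow> x = 0"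
proof
  assume "A *v x = 0"
  then have "real_mat A *v real_vec x = 0"
    by (simp add: real_mat_mult_vec vec_eq_iff)
  moreover have "inj ((*v) (real_mat A))"
    using assms by (intro inj_matrix_vector_mult) (simp add: invertible_det_nz det_real_mat)
  ultimately have "real_vec x = 0"
    by (metis inj_eq matrix_vector_mult_0_right)
  then show "x = 0"
    by (simp add: vec_eq_iff)
qed simp

lemma mult_vec_eq_iff:
  fixes A :: "int^'n^'n"
  assumes "det A \<noteq> 0"
  shows "A *v x = A *v y \<longleftrightarrow> x = y"
  using mult_vec_eq_0_iff[OF assms, of "x - y"] by (simp add: matrix_vector_mult_diff_distrib)

text \<open>Cramer's rule: after multiplication by \<open>det A\<close> the entries of the solution
  are determinants of integer matrices. So \<open>det A\<close> kills every class modulo the column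
  lattice.\<close>

lemma det_smult_in_range:
  fixes A :: "int^'n^'n"
  assumes "det A \<noteq> 0"
  obtains x where "A *v x = det A *s v"
proof -
  define x where "x = (\<chi> k. det (\<chi> i j. if j = k then v $ i else A $ i $ j))"
  define y where "y = (1 / det (real_mat A)) *s real_vec x"
  have nz: "det (real_mat A) \<noteq> 0"
    using assms by (simp add: det_real_mat)
  have "real_of_int (det (\<chi> i j. if j = k then v $ i else A $ i $ j)) =
        det (\<chi> i j. if j = k then real_vec v $ i else real_mat A $ i $ j)" for k
    by (subst det_real_mat[symmetric], rule arg_cong[where f = det])
       (simp add: vec_eq_iff real_mat_def)
  then have "real_mat A *v y = real_vec v"
    by (subst cramer[OF nz]) (simp add: y_def x_def vec_eq_iff)
  then have "real_mat A *v (det (real_mat A) *s y) = det (real_mat A) *s real_vec v"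
    by (simp only: vector_scalar_commute)
  moreover have "det (real_mat A) *s y = real_vec x"
    using nz by (simp add: y_def vec_eq_iff)
  moreover have "det (real_mat A) *s real_vec v = real_vec (det A *s v)"
    by (simp add: vec_eq_iff det_real_mat)
  ultimately have "real_vec (A *v x) = real_vec (det A *s v)"
    by (simp only: real_mat_mult_vec)
  then show thesis
    by (intro that) simp
qed

definition lattice_cong :: "int^'n^'n \<Rightarrow> int^'n \<Rightarrow> int^'n \<Rightarrow> bool" where
  "lattice_cong A v w \<longleftrightarrow> v - w \<in> range ((*v) A)"

lemma lattice_cong_refl [simp]: "lattice_cong A v v"
  unfolding lattice_cong_def by (auto intro: range_eqI[where x = 0])

lemma lattice_cong_sym: "lattice_cong A v w \<Longrightarrow> lattice_cong A w v"
proof -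
  assume "lattice_cong A v w"
  then obtain x where "v - w = A *v x"
    by (auto simp: lattice_cong_def)
  then have "w - v = A *v (- x)"
    by (metis matrix_vector_mult_diff_distrib minus_diff_eq diff_0 matrix_vector_mult_0_right)
  then show ?thesis
    by (auto simp: lattice_cong_def)
qed

lemma lattice_cong_trans: "lattice_cong A u v \<Longrightarrow> lattice_cong A v w \<Longrightarrow> lattice_cong A u w"
proof -
  assume "lattice_cong A u v" "lattice_cong A v w"
  then obtain x y where "u - v = A *v x" "v - w = A *v y"
    by (auto simp: lattice_cong_def)
  then have "u - w = A *v (x + y)"
    by (simp add: matrix_vector_right_distrib algebra_simps)
  then show ?thesis
    by (auto simp: lattice_cong_def)
qed

section \<open>Column exchange and the index of the column lattice\<close>

definition replace_column :: "int^'n^'n \<Rightarrow> 'n \<Rightarrow> int^'n \<Rightarrow> int^'n^'n" where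
  "replace_column A k v = (\<chi> i j. if j = k then v $ i else A $ i $ j)"

lemma det_replace_column_mult:
  "det (replace_column A k (A *v x)) = x $ k * det A"
proof -
  have "real_mat (replace_column A k (A *v x)) =
        (\<chi> i j. if j = k then (real_mat A *v real_vec x) $ i else real_mat A $ i $ j)"
    unfolding real_mat_mult_vec by (simp add: vec_eq_iff real_mat_def replace_column_def)
  then have "real_of_int (det (replace_column A k (A *v x))) = real_of_int (x $ k * det A)"
    unfolding det_real_mat[of "replace_column A k (A *v x)", symmetric]
    by (simp add: cramer_lemma det_real_mat)
  then show ?thesis
    by linarith
qed

lemma det_replace_column_smult:
  "det (replace_column A k (c *s v)) = c * det (replace_column A k v)"
proof -
  have "transpose (replace_column A k w) = (\<chi> i. if i = k then w else transpose A $ i)" for w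
    by (simp add: vec_eq_iff transpose_def replace_column_def)
  then show ?thesis
    using det_row_mul[of k c "\<lambda>_. v" "($) (transpose A)"]
    by (subst (1 2) det_transpose[symmetric]) simp
qed

text \<open>Isolates the new column, so that a congruence modulo the new lattice becomes one modulo
  the old lattice up to a multiple of \<open>v\<close>.\<close>

lemma replace_column_mult_vec:
  "replace_column A k v *v s = A *v (s - s $ k *s axis k 1) + s $ k *s v"
proof -
  have "(\<Sum>j\<in>UNIV. (if j = k then v $ i else A $ i $ j) * s $ j) =
        (\<Sum>j\<in>UNIV. A $ i $ j * (s $ j - s $ k * axis k 1 $ j) + (if j = k then s $ k * v $ i else 0))" for i
    by (rule sum.cong) (auto simp: axis_def algebra_simps)
  then show ?thesis
    by (simp add: vec_eq_iff matrix_vector_mult_def replace_column_def sum.distrib)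
qed

text \<open>Exchanging column \<open>k\<close> for \<open>v\<close> then enlarges the column lattice by the prime index \<open>p\<close>.\<close>

lemma prime_index_superlattice:
  fixes A :: "int^'n^'n"
  assumes "det A \<noteq> 0" "x \<notin> range ((*v) A)"
  obtains p :: nat and k v w where "prime p" "A *v w = int p *s v" "w $ k = 1"
proof -
  define P where "P m \<longleftrightarrow> 0 < m \<and> int m *s x \<in> range ((*v) A)" for m :: nat
  obtain y where "A *v y = det A *s x"
    using det_smult_in_range[OF assms(1)] by metis
  then have "A *v (sgn (det A) *s y) = (sgn (det A) * det A) *s x"
    by (simp only: matrix_vector_mult_smult vector_smult_assoc)
  also have "sgn (det A) * det A = int (nat \<bar>det A\<bar>)"
    by (simp add: sgn_if)
  finally have "int (nat \<bar>det A\<bar>) *s x \<in> range ((*v) A)"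
    by (metis rangeI)
  then have "P (nat \<bar>det A\<bar>)"
    using assms(1) unfolding P_def by simp
  \<comment> \<open>\<open>m\<close> is the order of \<open>x\<close> modulo the column lattice. If
    \<open>p\<close> is a prime and \<open>m = p * l\<close>, then \<open>int l *s x\<close> has
    order exactly \<open>p\<close>.\<close>
  define m where "m = (LEAST m. P m)"
  have "P m"
    unfolding m_def using \<open>P (nat \<bar>det A\<bar>)\<close> by (rule LeastI)
  have minimal: "\<not> P l" if "l < m" for l
    using that unfolding m_def by (rule not_less_Least)
  have "m \<noteq> 1"
    using \<open>P m\<close> assms(2) by (auto simp: P_def)
  then obtain p where p: "prime p" "p dvd m"
    using prime_factor_nat by blast
  then obtain l where l: "m = p * l"
    by (auto simp: dvd_def)
  have "0 < l" "l < m"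
    using \<open>P m\<close> l prime_gt_1_nat[OF p(1)] by (auto simp: P_def)
  then have "int l *s x \<notin> range ((*v) A)"
    using minimal by (auto simp: P_def)
  obtain w where w: "A *v w = int p *s (int l *s x)"
    using \<open>P m\<close> by (auto simp: P_def l vector_smult_assoc)
  have "\<exists>k. \<not> int p dvd w $ k"
  proof (rule ccontr)
    assume "\<not> ?thesis"
    then have "w = int p *s (\<chi> k. w $ k div int p)"
      by (simp add: vec_eq_iff)
    then have "int p *s (A *v (\<chi> k. w $ k div int p)) = int p *s (int l *s x)"
      using w by (metis matrix_vector_mult_smult)
    then have "A *v (\<chi> k. w $ k div int p) = int l *s x"
      using prime_gt_0_nat[OF p(1)] by (simp add: vec_eq_iff)
    then show False
      using \<open>int l *s x \<notin> range ((*v) A)\<close> by (metis rangeI)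
  qed
  then obtain k where "\<not> int p dvd w $ k"
    by blast
  then have "coprime (w $ k) (int p)"
    using p(1) by (metis coprime_commute prime_imp_coprime prime_nat_int_transfer)
  then obtain a b where ab: "a * w $ k + b * int p = 1"
    by (metis bezout_int coprime_imp_gcd_eq_1)
  \<comment> \<open>The Bezout coefficients turn the entry at \<open>k\<close> into 1, so that
    \<open>int p *s v'\<close> contains column \<open>k\<close> exactly once and \<open>v'\<close>
    can replace that column.\<close>
  define v' where "v' = a *s (int l *s x) + b *s (A *v axis k 1)"
  have "A *v (a *s w + (b * int p) *s axis k 1) = int p *s v'"
    by (simp add: matrix_vector_right_distrib matrix_vector_mult_smult w v'_def vec_eq_iff algebra_simps)
  moreover have "(a *s w + (b * int p) *s axis k 1) $ k = 1"
    using ab by simp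
  ultimately show thesis
    using that p(1) by blast
qed

text \<open>Induction on the determinant. If the column lattice is proper, a column exchange gives a
  larger lattice whose determinant is smaller by a prime factor \<open>p\<close>, and each class of
  the larger lattice splits into at most \<open>p\<close> classes of the smaller one.\<close>

theorem card_incongruent_le_det:
  fixes A :: "int^'n^'n"
  assumes "det A \<noteq> 0" "finite V" "pairwise (\<lambda>v w. \<not> lattice_cong A v w) V"
  shows "int (card V) \<le> \<bar>det A\<bar>"
  using assms
proof (induction "nat \<bar>det A\<bar>" arbitrary: A V rule: less_induct)
  case less
  show ?case
  proof (cases "range ((*v) A) = UNIV")
    case True
    then have "card V \<le> 1"
      using less.prems(2,3)
      by (auto simp: card_le_Suc0_iff_eq pairwise_def lattice_cong_def)
    moreover have "1 \<le> \<bar>det A\<bar>"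
      using less.prems(1) by linarith
    ultimately show ?thesis
      by linarith
  next
    case False
    then obtain x where "x \<notin> range ((*v) A)"
      by blast
    with less.prems(1) obtain p :: nat and k v w
      where p: "prime p" and w: "A *v w = int p *s v" "w $ k = 1"
      by (rule prime_index_superlattice)
    define B where "B = replace_column A k v"
    have detB: "int p * det B = det A"
      using det_replace_column_mult[of A k w] by (simp add: w B_def det_replace_column_smult)
    then have "det B \<noteq> 0"
      using less.prems(1) by auto
    have "1 < int p"
      using prime_gt_1_nat[OF p] by simp
    then have "\<bar>det B\<bar> < \<bar>det A\<bar>"
      using \<open>det B \<noteq> 0\<close> by (simp add: detB[symmetric] abs_mult)
    \<comment> \<open>A representative in \<open>V\<close> that depends only on the class modulo the
      lattice of \<open>B\<close>; hence distinct values of \<open>r\<close> are again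
      incongruent.\<close>
    define r where "r x = (SOME y. y \<in> V \<and> lattice_cong B y x)" for x
    have r: "r x \<in> V \<and> lattice_cong B (r x) x" if "x \<in> V" for x
      unfolding r_def by (rule someI[of _ x]) (simp add: that)
    have "\<not> lattice_cong B y z" if rV: "y \<in> r ` V" "z \<in> r ` V" "y \<noteq> z" for y z
    proof
      assume yz: "lattice_cong B y z"
      obtain a b where ab: "a \<in> V" "b \<in> V" "y = r a" "z = r b"
        using rV by blast
      have "lattice_cong B a b"
        using r ab yz lattice_cong_trans lattice_cong_sym by metis
      then have "lattice_cong B c a \<longleftrightarrow> lattice_cong B c b" for c
        using lattice_cong_trans lattice_cong_sym by metis
      then have "r a = r b"
        by (simp add: r_def)
      with ab rV show False
        by simp
    qed
    then have "int (card (r ` V)) \<le> \<bar>det B\<bar>"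
      using \<open>det B \<noteq> 0\<close> \<open>\<bar>det B\<bar> < \<bar>det A\<bar>\<close> less.prems(2)
      by (intro less.hyps) (auto simp: pairwise_def)
    \<comment> \<open>Modulo the lattice of \<open>A\<close>, \<open>x\<close> and
      \<open>r x\<close> differ by a multiple of \<open>v\<close>; since \<open>int p *s v\<close>
      lies in that lattice, only the residue of the coefficient counts.\<close>
    have "\<exists>c::nat. c < p \<and> lattice_cong A x (r x + int c *s v)" if xV: "x \<in> V" for x
    proof -
      obtain s where s: "x - r x = B *v s"
        using lattice_cong_sym[of B "r x" x] r[OF xV] by (auto simp: lattice_cong_def)
      define c where "c = nat (s $ k mod int p)"
      have "int c = s $ k mod int p"
        using \<open>1 < int p\<close> by (simp add: c_def)
      then have sk: "s $ k = int p * (s $ k div int p) + int c"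
        by simp
      have "x - (r x + int c *s v) = A *v (s - s $ k *s axis k 1) + (s $ k - int c) *s v"
        using s by (simp add: B_def replace_column_mult_vec vec_eq_iff algebra_simps)
      also have "(s $ k - int c) *s v = A *v ((s $ k div int p) *s w)"
        by (subst sk) (simp add: matrix_vector_mult_smult w vec_eq_iff)
      finally have "lattice_cong A x (r x + int c *s v)"
        unfolding lattice_cong_def matrix_vector_right_distrib[symmetric] by simp
      moreover have "c < p"
        using \<open>int c = s $ k mod int p\<close> \<open>1 < int p\<close> pos_mod_bound[of "int p" "s $ k"] by linarith
      ultimately show ?thesis
        by blast
    qed
    then obtain c where c: "c x < p" "lattice_cong A x (r x + int (c x) *s v)" if "x \<in> V" for x
      by metis
    have "inj_on (\<lambda>x. (r x, c x)) V"
    proof (rule inj_onI)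
      fix y z assume yz: "y \<in> V" "z \<in> V" "(r y, c y) = (r z, c z)"
      then have "lattice_cong A y z"
        using c(2)[of y] c(2)[of z] lattice_cong_trans lattice_cong_sym by (metis prod.inject)
      then show "y = z"
        using less.prems(3) yz by (auto simp: pairwise_def)
    qed
    moreover have "(\<lambda>x. (r x, c x)) ` V \<subseteq> r ` V \<times> {..<p}"
      using c(1) by auto
    ultimately have "card V \<le> card (r ` V \<times> {..<p})"
      using less.prems(2) by (intro card_inj_on_le) auto
    then have "int (card V) \<le> int (card (r ` V)) * int p"
      by (simp add: card_cartesian_product flip: of_nat_mult)
    also have "\<dots> \<le> \<bar>det B\<bar> * int p"
      using \<open>int (card (r ` V)) \<le> \<bar>det B\<bar>\<close> by (intro mult_right_mono) auto
    also have "\<dots> = \<bar>det A\<bar>"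
      by (simp add: detB[symmetric] abs_mult)
    finally show ?thesis .
  qed
qed

section \<open>Irreducible lattice points of a simplicial cone\<close>

locale nonsingular_matrix =
  fixes A :: "int^'n^'n"
  assumes det_nonzero: "det A \<noteq> 0"
begin

definition slack :: "'n \<Rightarrow> int^'n \<Rightarrow> int" where
  "slack i x = (A *v x) $ i"

lemma slack_simps [simp]:
  "slack i 0 = 0"
  "slack i (x + y) = slack i x + slack i y"
  "slack i (x - y) = slack i x - slack i y"
  "slack i (c *s x) = c * slack i x"
  by (simp_all add: slack_def matrix_vector_right_distrib matrix_vector_mult_diff_distrib
      matrix_vector_mult_smult)

lemma slack_sum [simp]: "slack i (\<Sum>h\<in>S. f h) = (\<Sum>h\<in>S. slack i (f h))"
  by (induction S rule: infinite_finite_induct) auto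

lemma slack_eqI: "(\<And>i. slack i x = slack i y) \<Longrightarrow> x = y"
  using mult_vec_eq_iff[OF det_nonzero, of x y] by (simp add: slack_def vec_eq_iff[of "A *v x"])

definition cone_points :: "(int^'n) set" where
  "cone_points = {x. \<forall>i. 0 \<le> slack i x}"

text \<open>The irreducible elements of the monoid, which turn out to form the Hilbert
  basis.\<close>

definition atoms :: "(int^'n) set" where
  "atoms = {h \<in> cone_points. h \<noteq> 0 \<and>
     (\<forall>u\<in>cone_points. \<forall>v\<in>cone_points. h = u + v \<longrightarrow> u = 0 \<or> v = 0)}"

lemma cone_points_0 [simp]: "0 \<in> cone_points"
  by (simp add: cone_points_def)

lemma cone_points_add: "x \<in> cone_points \<Longrightarrow> y \<in> cone_points \<Longrightarrow> x + y \<in> cone_points"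
  by (simp add: cone_points_def)

lemma cone_points_smult: "x \<in> cone_points \<Longrightarrow> 0 \<le> c \<Longrightarrow> c *s x \<in> cone_points"
  by (simp add: cone_points_def)

lemma cone_points_sum: "(\<And>h. h \<in> S \<Longrightarrow> f h \<in> cone_points) \<Longrightarrow> (\<Sum>h\<in>S. f h) \<in> cone_points"
  by (simp add: cone_points_def sum_nonneg)

lemma slack_nonneg: "x \<in> cone_points \<Longrightarrow> 0 \<le> slack i x"
  by (simp add: cone_points_def)

lemma atoms_cone: "h \<in> atoms \<Longrightarrow> h \<in> cone_points"
  by (simp add: atoms_def)

lemma zero_notin_atoms [simp]: "0 \<notin> atoms"
  by (simp add: atoms_def)

lemma atomD: "h \<in> atoms \<Longrightarrow> h = u + v \<Longrightarrow> u \<in> cone_points \<Longrightarrow> v \<in> cone_points \<Longrightarrow> u = 0 \<or> v = 0"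
  unfolding atoms_def by blast

text \<open>An additive size, positive on nonzero cone points; the measure for the inductions on
  decompositions.\<close>

definition total_slack :: "int^'n \<Rightarrow> int" where
  "total_slack x = (\<Sum>i\<in>UNIV. slack i x)"

lemma total_slack_add: "total_slack (x + y) = total_slack x + total_slack y"
  by (simp add: total_slack_def sum.distrib)

lemma total_slack_diff: "total_slack (x - y) = total_slack x - total_slack y"
  by (simp add: total_slack_def sum_subtractf)

lemma total_slack_pos:
  assumes "x \<in> cone_points" "x \<noteq> 0"
  shows "0 < total_slack x"
proof -
  have "total_slack x \<noteq> 0"
  proof
    assume "total_slack x = 0"
    then have "slack i x = 0" for i
      using assms(1) by (simp add: total_slack_def cone_points_def sum_nonneg_eq_0_iff)
    then show False
      using slack_eqI[of x 0] assms(2) by simp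
  qed
  moreover have "0 \<le> total_slack x"
    using assms(1) by (simp add: total_slack_def cone_points_def sum_nonneg)
  ultimately show ?thesis
    by simp
qed

lemma atom_below:
  assumes "x \<in> cone_points" "x \<noteq> 0"
  shows "\<exists>h\<in>atoms. x - h \<in> cone_points"
  using assms
proof (induction "nat (total_slack x)" arbitrary: x rule: less_induct)
  case less
  show ?case
  proof (cases "x \<in> atoms")
    case True
    then show ?thesis
      by (intro bexI[of _ x]) auto
  next
    case False
    then obtain u v where uv: "u \<in> cone_points" "v \<in> cone_points" "x = u + v" "u \<noteq> 0" "v \<noteq> 0"
      using less.prems by (auto simp: atoms_def)
    then have "nat (total_slack u) < nat (total_slack x)"
      using total_slack_pos[of u] total_slack_pos[of v] by (simp add: total_slack_add)
    then obtain h where "h \<in> atoms" "u - h \<in> cone_points"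
      using less.hyps uv by blast
    moreover have "x - h = (u - h) + v"
      by (simp add: uv)
    ultimately show ?thesis
      using cone_points_add uv(2) by metis
  qed
qed

lemma axis_multiple:
  obtains u where "\<And>k. slack k u = (if k = i then \<bar>det A\<bar> else 0)"
proof -
  obtain y where y: "A *v y = det A *s axis i 1"
    using det_smult_in_range[OF det_nonzero] by metis
  have "slack k y = (if k = i then det A else 0)" for k
    by (simp add: slack_def y axis_def)
  then show thesis
    by (intro that[of "sgn (det A) *s y"]) (simp add: sgn_if)
qed

text \<open>An atom with a slack above the absolute determinant would allow a point of an extreme
  ray to be split off, so the slack vectors of atoms lie in a finite box.\<close>

lemma finite_atoms: "finite atoms"
proof -
  define D where "D = \<bar>det A\<bar>"
  have "0 < D"
    using det_nonzero by (simp add: D_def)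
  have "slack i h \<le> D" if h: "h \<in> atoms" for h i
  proof (rule ccontr)
    assume "\<not> slack i h \<le> D"
    obtain u where u: "slack k u = (if k = i then D else 0)" for k
      using axis_multiple[of i] D_def by metis
    have "u \<in> cone_points" "h - u \<in> cone_points"
      using atoms_cone[OF h] \<open>\<not> slack i h \<le> D\<close> \<open>0 < D\<close> by (auto simp: cone_points_def u)
    then have "u = 0 \<or> h - u = 0"
      using atomD[OF h, of u "h - u"] by simp
    then have "slack i u = 0 \<or> slack i (h - u) = 0"
      by auto
    then show False
      using u[of i] \<open>0 < D\<close> \<open>\<not> slack i h \<le> D\<close> by simp
  qed
  then have "(\<lambda>h i. slack i h) ` atoms \<subseteq> PiE UNIV (\<lambda>_. {0..D})"
    using slack_nonneg[OF atoms_cone] by auto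
  then have "finite ((\<lambda>h i. slack i h) ` atoms)"
    by (rule finite_subset) (simp add: finite_PiE)
  moreover have "inj (\<lambda>h i. slack i h)"
    by (rule injI) (metis slack_eqI)
  ultimately show ?thesis
    using finite_imageD inj_on_subset by blast
qed

lemma atom_combination:
  assumes "x \<in> cone_points"
  shows "\<exists>c :: int^'n \<Rightarrow> nat. x = (\<Sum>h\<in>atoms. int (c h) *s h)"
  using assms
proof (induction "nat (total_slack x)" arbitrary: x rule: less_induct)
  case less
  show ?case
  proof (cases "x = 0")
    case True
    then show ?thesis
      by (intro exI[of _ "\<lambda>_. 0"]) (simp add: vec_eq_iff)
  next
    case False
    then obtain h where h: "h \<in> atoms" "x - h \<in> cone_points"
      using atom_below less.prems by blast
    then have "0 < total_slack h"
      using total_slack_pos atoms_cone by fastforce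
    then have "nat (total_slack (x - h)) < nat (total_slack x)"
      using total_slack_pos[OF less.prems False] by (simp add: total_slack_diff)
    then obtain c :: "int^'n \<Rightarrow> nat" where c: "x - h = (\<Sum>g\<in>atoms. int (c g) *s g)"
      using less.hyps h(2) by blast
    have "(\<Sum>g\<in>atoms. int ((c(h := Suc (c h))) g) *s g) =
          (\<Sum>g\<in>atoms. int (c g) *s g + (if g = h then h else 0))"
      by (rule sum.cong) (auto simp: vector_sadd_rdistrib add.commute)
    also have "\<dots> = x"
      using h(1) by (simp add: sum.distrib finite_atoms c[symmetric])
    finally show ?thesis
      by metis
  qed
qed

section \<open>Sums of few atoms and dimension reductions\<close>

text \<open>\<open>l\<close> bounds the number of terms, not their multiplicities: one
  \<open>add\<close> step admits any multiple of an atom, and atoms may repeat.\<close>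

inductive short_sum :: "nat \<Rightarrow> int^'n \<Rightarrow> bool" where
  zero: "short_sum 0 0"
| weaken: "short_sum l x \<Longrightarrow> short_sum (Suc l) x"
| add: "short_sum l x \<Longrightarrow> h \<in> atoms \<Longrightarrow> short_sum (Suc l) (x + int c *s h)"

lemma short_sum_mono: "short_sum k x \<Longrightarrow> k \<le> l \<Longrightarrow> short_sum l x"
  by (induction l) (auto simp: le_Suc_eq intro: short_sum.weaken)

lemma short_sum_add: "short_sum k x \<Longrightarrow> short_sum l y \<Longrightarrow> short_sum (k + l) (x + y)"
  by (rotate_tac, induction rule: short_sum.induct)
     (auto simp: add.assoc[symmetric] intro: short_sum.intros)

lemma short_sum_Suc: "short_sum l (x - int c *s h) \<Longrightarrow> h \<in> atoms \<Longrightarrow> short_sum (Suc l) x"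
  using short_sum.add[of l "x - int c *s h" h c] by simp

lemma short_sum_combination:
  assumes "finite S" "S \<subseteq> atoms"
  shows "short_sum (card {h\<in>S. c h \<noteq> 0}) (\<Sum>h\<in>S. int (c h) *s h)"
proof -
  have *: "short_sum (card T) (\<Sum>h\<in>T. int (c h) *s h)" if "finite T" "T \<subseteq> atoms" for T
    using that
  proof (induction T rule: finite_induct)
    case (insert h T)
    then show ?case
      using short_sum.add[of "card T" "\<Sum>h\<in>T. int (c h) *s h" h "c h"] by (simp add: add.commute)
  qed (simp add: short_sum.zero)
  have "(\<Sum>h\<in>S. int (c h) *s h) = (\<Sum>h\<in>{h\<in>S. c h \<noteq> 0}. int (c h) *s h)"
    by (rule sum.mono_neutral_right) (use assms in auto)
  then show ?thesis
    using *[of "{h\<in>S. c h \<noteq> 0}"] assms by (metis (no_types, lifting) finite_subset mem_Collect_eq subset_eq)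
qed

lemma short_sum_le_sum:
  assumes "finite S" "S \<subseteq> atoms" "(\<Sum>h\<in>S. c h) \<le> l"
  shows "short_sum l (\<Sum>h\<in>S. int (c h) *s h)"
proof -
  have "card {h\<in>S. c h \<noteq> 0} = (\<Sum>h\<in>{h\<in>S. c h \<noteq> 0}. 1)"
    by simp
  also have "\<dots> \<le> (\<Sum>h\<in>{h\<in>S. c h \<noteq> 0}. c h)"
    by (rule sum_mono) auto
  also have "\<dots> \<le> (\<Sum>h\<in>S. c h)"
    using assms(1) by (intro sum_mono2) auto
  finally show ?thesis
    using assms(3) by (intro short_sum_mono[OF short_sum_combination[OF assms(1,2)]]) simp
qed

lemma short_sum_indexed:
  assumes "short_sum l x"
  shows "\<exists>l'\<le>l. \<exists>(h :: nat \<Rightarrow> int^'n) (c :: nat \<Rightarrow> nat).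
    (\<forall>i<l'. h i \<in> atoms) \<and> x = (\<Sum>i<l'. int (c i) *s h i)"
  using assms
proof (induction rule: short_sum.induct)
  case zero
  then show ?case
    by simp
next
  case (weaken l x)
  then show ?case
    using le_SucI by metis
next
  case (add l x g k)
  then obtain l' h c where *: "l' \<le> l" "\<forall>i<l'. h i \<in> atoms" "x = (\<Sum>i<l'. int (c i) *s h i)"
    by blast
  have "x + int k *s g = (\<Sum>i<Suc l'. int ((c(l' := k)) i) *s (h(l' := g)) i)"
    by (simp add: *(3))
  moreover have "\<forall>i<Suc l'. (h(l' := g)) i \<in> atoms"
    using add.hyps(2) *(2) by (simp add: less_Suc_eq)
  ultimately show ?case
    using *(1) by (metis Suc_le_mono)
qed

section \<open>Faces of the cone, and clearing a coordinate\<close>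

definition face_points :: "'n set \<Rightarrow> (int^'n) set" where
  "face_points I = {x \<in> cone_points. \<forall>i. i \<notin> I \<longrightarrow> slack i x = 0}"

lemma face_points_UNIV [simp]: "face_points UNIV = cone_points"
  by (simp add: face_points_def)

lemma face_points_empty [simp]: "face_points {} = {0}"
  using slack_eqI[of _ 0] by (auto simp: face_points_def)

text \<open>An atom below \<open>u\<close> has only slacks 0 and 1. Subtracting it until some slack
  in its support vanishes leaves a point of a smaller face, at the price of this one atom.\<close>

lemma reduce_zero_one:
  assumes u: "u \<in> face_points I" "u \<noteq> 0" "\<And>i. slack i u \<le> 1"
    and IH: "\<And>j y. j \<in> I \<Longrightarrow> y \<in> face_points (I - {j}) \<Longrightarrow> short_sum m y"
    and x: "x \<in> face_points I"
  shows "short_sum (Suc m) x"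
proof -
  have "u \<in> cone_points"
    using u(1) by (simp add: face_points_def)
  then obtain h where h: "h \<in> atoms" "u - h \<in> cone_points"
    using u(2) atom_below by blast
  have "0 \<le> slack i h \<and> slack i h \<le> slack i u" for i
    using slack_nonneg[OF atoms_cone[OF h(1)], of i] slack_nonneg[OF h(2), of i] by simp
  note h_le_u = this
  have h01: "slack i h = 0 \<or> slack i h = 1" "i \<notin> I \<Longrightarrow> slack i h = 0" for i
    using h_le_u[of i] u(3)[of i] u(1) by (smt (verit) face_points_def mem_Collect_eq)+
  define S where "S = {i. slack i h = 1}"
  have "S \<noteq> {}"
    using slack_eqI[of h 0] h01(1) h(1) by (force simp: S_def)
  define c where "c = Min ((\<lambda>i. slack i x) ` S)"
  have "c \<in> (\<lambda>i. slack i x) ` S"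
    unfolding c_def using \<open>S \<noteq> {}\<close> by (intro Min_in) auto
  then obtain j where j: "j \<in> S" "slack j x = c"
    by auto
  have cle: "c \<le> slack i x" if "i \<in> S" for i
    unfolding c_def using that by (intro Min_le) auto
  have x0: "0 \<le> slack i x" for i
    using x by (simp add: face_points_def slack_nonneg)
  then have "0 \<le> c"
    using j by auto
  have "j \<in> I"
    using j h01(2)[of j] by (auto simp: S_def)
  have "0 \<le> slack i (x - c *s h)" for i
    using h01(1)[of i] cle[of i] x0[of i] by (auto simp: S_def)
  moreover have "slack i (x - c *s h) = 0" if "i \<notin> I - {j}" for i
    using that j x h01(2)[of i] by (auto simp: S_def face_points_def)
  ultimately have "x - int (nat c) *s h \<in> face_points (I - {j})"
    using \<open>0 \<le> c\<close> unfolding face_points_def cone_points_def by simp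
  then show ?thesis
    using IH \<open>j \<in> I\<close> h(1) short_sum_Suc by blast
qed

section \<open>Shifting slack between two coordinates whose unit vectors are congruent\<close>

context
  fixes d :: "int^'n" and i j :: 'n
  assumes ij: "i \<noteq> j" and d: "A *v d = axis i 1 - axis j 1"
begin

lemma slack_shift: "slack k d = (if k = i then 1 else if k = j then -1 else 0)"
  using ij by (simp add: slack_def d axis_def)

lemma shift_cone:
  assumes "x \<in> cone_points" "0 \<le> a" "a \<le> slack i x"
  shows "x - a *s d \<in> cone_points"
proof -
  have "0 \<le> slack k (x - a *s d)" for k
    using assms slack_nonneg[of x k] by (auto simp: slack_shift)
  then show ?thesis
    by (simp add: cone_points_def)
qed

text \<open>A decomposition of the shifted atom can be shifted back, with \<open>a\<close> divided
  between \<open>u\<close> and \<open>v\<close> as their slacks at \<open>j\<close> permit.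
  Irreducibility of \<open>h\<close> makes one part 0, and its slack at \<open>i\<close> shows that
  its share of the shift was 0, so \<open>u\<close> or \<open>v\<close> itself is 0.\<close>

lemma shift_atom:
  assumes h: "h \<in> atoms" and a: "0 \<le> a" "a \<le> slack i h"
  shows "h - a *s d \<in> atoms"
proof -
  have "u = 0 \<or> v = 0"
    if uv: "u \<in> cone_points" "v \<in> cone_points" "h - a *s d = u + v" for u v
  proof -
    have "slack j u + slack j v = slack j h + a"
      using arg_cong[OF uv(3), of "slack j"] ij by (simp add: slack_shift)
    then have "a \<le> slack j u + slack j v"
      using slack_nonneg[OF atoms_cone[OF h], of j] by simp
    define b where "b = min a (slack j u)"
    have b: "0 \<le> b" "b \<le> slack j u" "0 \<le> a - b" "a - b \<le> slack j v"
      using a \<open>a \<le> slack j u + slack j v\<close> slack_nonneg[OF uv(1), of j] slack_nonneg[OF uv(2), of j]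
      by (auto simp: b_def)
    have "h = (u + b *s d) + (v + (a - b) *s d)"
      using uv(3) by (simp add: vec_eq_iff algebra_simps)
    moreover have "u + b *s d \<in> cone_points" "v + (a - b) *s d \<in> cone_points"
      using uv b ij by (auto simp: cone_points_def slack_shift)
    ultimately have "u + b *s d = 0 \<or> v + (a - b) *s d = 0"
      using atomD[OF h] by blast
    then have "slack i (u + b *s d) = 0 \<and> u + b *s d = 0 \<or>
        slack i (v + (a - b) *s d) = 0 \<and> v + (a - b) *s d = 0"
      by (metis slack_simps(1))
    moreover have "b = 0" if "slack i (u + b *s d) = 0"
      using that b slack_nonneg[OF uv(1), of i] by (simp add: slack_shift)
    moreover have "a - b = 0" if "slack i (v + (a - b) *s d) = 0"
      using that b slack_nonneg[OF uv(2), of i] by (simp add: slack_shift)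
    ultimately show ?thesis
      by force
  qed
  moreover have "h - a *s d \<noteq> 0"
  proof
    assume *: "h - a *s d = 0"
    then have "slack j (h - a *s d) = 0"
      by simp
    then have "a = 0"
      using ij a slack_nonneg[OF atoms_cone[OF h], of j] by (simp add: slack_shift)
    then show False
      using * h by simp
  qed
  ultimately show ?thesis
    using shift_cone[OF atoms_cone[OF h] a] unfolding atoms_def by blast
qed

text \<open>A complete shift is linear and carries atoms to atoms, so it costs nothing.\<close>

lemma short_sum_shift_all: "short_sum l x \<Longrightarrow> short_sum l (x - slack i x *s d)"
proof (induction rule: short_sum.induct)
  case (add l x h c)
  have "x + int c *s h - slack i (x + int c *s h) *s d =
        (x - slack i x *s d) + int c *s (h - slack i h *s d)"
    by (simp add: vec_eq_iff algebra_simps)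
  moreover have "short_sum (Suc l) ((x - slack i x *s d) + int c *s (h - slack i h *s d))"
    by (intro short_sum.add add.IH shift_atom add.hyps slack_nonneg atoms_cone order_refl)
  ultimately show ?case
    by (simp only:)
qed (auto intro: short_sum.intros)

text \<open>Only one multiple \<open>c *s h\<close> needs to be shifted partially, and \<open>c\<close> copies of \<open>h\<close>
  absorb a total shift \<open>t\<close> as evenly as possible, so that only two distinct atoms arise from it.\<close>

lemma short_sum_shift:
  "short_sum l x \<Longrightarrow> 0 \<le> s \<Longrightarrow> s \<le> slack i x \<Longrightarrow> short_sum (Suc l) (x - s *s d)"
proof (induction arbitrary: s rule: short_sum.induct)
  case zero
  then show ?case
    using short_sum.weaken[OF short_sum.zero] by simp
next
  case (weaken l x)
  then show ?case
    using short_sum.weaken by blast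
next
  case (add l x h c)
  show ?case
  proof (cases "s \<le> slack i x")
    case True
    then have "short_sum (Suc (Suc l)) (x - s *s d + int c *s h)"
      using add by (intro short_sum.add) auto
    then show ?thesis
      by (simp add: algebra_simps)
  next
    case False
    \<comment> \<open>Shifting \<open>x\<close> completely is free; \<open>t\<close> is the part of
      \<open>s\<close> left for the copies of \<open>h\<close>, of which \<open>c - r\<close> are
      shifted by \<open>q\<close> and \<open>r\<close> by \<open>q + 1\<close>.\<close>
    define t where "t = s - slack i x"
    have t: "0 < t" "t \<le> int c * slack i h"
      using False add.prems by (auto simp: t_def)
    have "c \<noteq> 0"
      using t by (intro notI) simp
    define q r where "q = t div int c" and "r = t mod int c"
    have tqr: "t = int c * q + r"
      by (simp add: q_def r_def)
    have r: "0 \<le> r" "r < int c" and "0 \<le> q"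
      using t \<open>c \<noteq> 0\<close> by (auto simp: q_def r_def pos_imp_zdiv_nonneg_iff)
    have "int c * q \<le> int c * slack i h"
      using t tqr r by linarith
    then have "q \<le> slack i h"
      using \<open>c \<noteq> 0\<close> by simp
    have "short_sum (Suc l) ((x - slack i x *s d) + int (nat (int c - r)) *s (h - q *s d))"
      by (intro short_sum.add short_sum_shift_all shift_atom add.hyps \<open>0 \<le> q\<close> \<open>q \<le> slack i h\<close>)
    then have *: "short_sum (Suc l) ((x - slack i x *s d) + (int c - r) *s (h - q *s d))"
      using r by simp
    have "short_sum (Suc (Suc l)) ((x - slack i x *s d) + (int c - r) *s (h - q *s d)
        + r *s (h - (q + 1) *s d))"
    proof (cases "r = 0")
      case True
      then show ?thesis
        using short_sum.weaken[OF *] by simp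
    next
      case False
      then have "int c * q < int c * slack i h"
        using t tqr r by linarith
      then have "q < slack i h"
        using \<open>c \<noteq> 0\<close> by simp
      then have "h - (q + 1) *s d \<in> atoms"
        using \<open>0 \<le> q\<close> by (intro shift_atom add.hyps) auto
      then show ?thesis
        using short_sum.add[OF *, of "h - (q + 1) *s d" "nat r"] r by (simp only: nat_0_le)
    qed
    moreover have "s = slack i x + int c * q + r"
      using tqr by (simp add: t_def)
    then have "x + int c *s h - s *s d =
        (x - slack i x *s d) + (int c - r) *s (h - q *s d) + r *s (h - (q + 1) *s d)"
      by (simp add: vec_eq_iff algebra_simps)
    ultimately show ?thesis
      by (simp only:)
  qed
qed

text \<open>Moving all slack from \<open>j\<close> to \<open>i\<close> lands in the smaller face;
  moving the original amount back costs one more atom by \<open>short_sum_shift\<close>.\<close>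

lemma reduce_shift:
  assumes IH: "\<And>y. y \<in> face_points (I - {j}) \<Longrightarrow> short_sum m y"
    and I: "i \<in> I" and x: "x \<in> face_points I"
  shows "short_sum (Suc m) x"
proof -
  have x0: "0 \<le> slack k x" for k
    using x by (simp add: face_points_def slack_nonneg)
  have "x + slack j x *s d \<in> face_points (I - {j})"
    using x0 x ij I by (auto simp: face_points_def cone_points_def slack_shift add_nonneg_nonneg)
  then have "short_sum m (x + slack j x *s d)"
    by (rule IH)
  then have "short_sum (Suc m) (x + slack j x *s d - slack j x *s d)"
    using x0 ij by (intro short_sum_shift) (auto simp: slack_shift)
  then show ?thesis
    by simp
qed

end

section \<open>Sebo's bound\<close>

text \<open>The feasible set of a linear program: real nonnegative combinations of atoms
  representing \<open>x\<close>. Fixing the values off \<open>atoms\<close> to 0 makes it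
  compact.\<close>

definition weights :: "int^'n \<Rightarrow> (int^'n \<Rightarrow> real) set" where
  "weights x = {\<kappa>. (\<forall>h. 0 \<le> \<kappa> h) \<and> (\<forall>h. h \<notin> atoms \<longrightarrow> \<kappa> h = 0) \<and>
     (\<forall>i. (\<Sum>h\<in>atoms. \<kappa> h * slack i h) = slack i x)}"

text \<open>The squared Euclidean length of the slack vector, a secondary cost that breaks ties
  between weights of equal total.\<close>

definition sq_slack :: "int^'n \<Rightarrow> real" where
  "sq_slack h = (\<Sum>i\<in>UNIV. (real_of_int (slack i h))\<^sup>2)"

lemma weightsD:
  assumes "\<kappa> \<in> weights x"
  shows "0 \<le> \<kappa> h" "h \<notin> atoms \<Longrightarrow> \<kappa> h = 0" "(\<Sum>h\<in>atoms. \<kappa> h * slack i h) = slack i x"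
  using assms by (auto simp: weights_def)

lemma real_slack_nonneg: "h \<in> atoms \<Longrightarrow> 0 \<le> real_of_int (slack i h)"
  by (simp add: slack_nonneg atoms_cone)

lemma real_slack_combination:
  assumes "x = (\<Sum>h\<in>atoms. int (c h) *s h)"
  shows "real_of_int (slack i x) = (\<Sum>h\<in>atoms. real (c h) * slack i h)"
  by (simp add: assms)

lemma weights_nonempty:
  assumes "x \<in> cone_points"
  shows "weights x \<noteq> {}"
proof -
  obtain c :: "int^'n \<Rightarrow> nat" where "x = (\<Sum>h\<in>atoms. int (c h) *s h)"
    using atom_combination[OF assms] by blast
  then have "(\<lambda>h. if h \<in> atoms then real (c h) else 0) \<in> weights x"
    by (simp add: weights_def real_slack_combination)
  then show ?thesis
    by blast
qed

text \<open>Every atom has total slack at least 1, so no weight exceeds the total slack of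
  \<open>x\<close>, and the set is closed in a product of compact intervals.\<close>

lemma compact_weights: "compact (weights x)"
proof -
  define N where "N = real_of_int (total_slack x)"
  define B where "B h = {0..if h \<in> atoms then N else 0}" for h :: "int^'n"
  have "compactin (product_topology (\<lambda>_. euclidean) UNIV) (PiE UNIV B)"
    unfolding compactin_PiE by (auto simp: B_def)
  then have "compact (PiE UNIV B)"
    by (simp add: euclidean_product_topology)
  moreover have "closed (weights x)"
    unfolding weights_def
    by (intro closed_Collect_conj closed_Collect_all closed_Collect_imp closed_Collect_le
        closed_Collect_eq continuous_intros continuous_on_product_coordinates open_Collect_const)
  moreover have "weights x \<subseteq> PiE UNIV B"
  proof
    fix \<kappa> assume \<kappa>: "\<kappa> \<in> weights x"
    have "\<kappa> h \<le> N" if h: "h \<in> atoms" for h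
    proof -
      have "1 \<le> total_slack h"
        using total_slack_pos[OF atoms_cone[OF h]] h by (metis int_one_le_iff_zero_less zero_notin_atoms)
      then have "\<kappa> h * 1 \<le> \<kappa> h * total_slack h"
        using weightsD(1)[OF \<kappa>] by (intro mult_left_mono) auto
      also have "\<dots> = (\<Sum>i\<in>UNIV. \<kappa> h * slack i h)"
        by (simp add: total_slack_def sum_distrib_left)
      also have "\<dots> \<le> (\<Sum>i\<in>UNIV. (\<Sum>g\<in>atoms. \<kappa> g * slack i g))"
        using weightsD(1)[OF \<kappa>] h
        by (intro sum_mono member_le_sum[where f = "\<lambda>g. \<kappa> g * slack _ g"] finite_atoms)
           (auto intro!: mult_nonneg_nonneg simp: slack_nonneg atoms_cone)
      also have "\<dots> = N"
        by (simp add: weightsD(3)[OF \<kappa>] N_def total_slack_def)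
      finally show ?thesis
        by simp
    qed
    then show "\<kappa> \<in> PiE UNIV B"
      using weightsD(1,2)[OF \<kappa>] by (auto simp: B_def)
  qed
  ultimately show ?thesis
    by (metis compact_Int_closed inf.absorb_iff2)
qed

text \<open>Lexicographic optimization: maximal total weight, then minimal quadratic cost, then
  minimal support. Compactness yields the first two optima, well-ordering of the naturals the
  third.\<close>

lemma optimal_weights:
  assumes "x \<in> cone_points"
  obtains \<kappa> where "\<kappa> \<in> weights x"
    "\<And>\<mu>. \<mu> \<in> weights x \<Longrightarrow> sum \<mu> atoms \<le> sum \<kappa> atoms"
    "\<And>\<mu>. \<mu> \<in> weights x \<Longrightarrow> sum \<mu> atoms = sum \<kappa> atoms \<Longrightarrow>
       (\<Sum>h\<in>atoms. \<kappa> h * sq_slack h) \<le> (\<Sum>h\<in>atoms. \<mu> h * sq_slack h)"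
    "\<And>\<mu>. \<mu> \<in> weights x \<Longrightarrow> sum \<mu> atoms = sum \<kappa> atoms \<Longrightarrow>
       (\<Sum>h\<in>atoms. \<mu> h * sq_slack h) = (\<Sum>h\<in>atoms. \<kappa> h * sq_slack h) \<Longrightarrow>
       card {h. \<kappa> h \<noteq> 0} \<le> card {h. \<mu> h \<noteq> 0}"
proof -
  have cont: "continuous_on UNIV (\<lambda>\<kappa> :: int^'n \<Rightarrow> real. \<Sum>h\<in>atoms. \<kappa> h * f h)" for f
    by (intro continuous_intros continuous_on_product_coordinates)
  have cont1: "continuous_on UNIV (\<lambda>\<kappa> :: int^'n \<Rightarrow> real. \<Sum>h\<in>atoms. \<kappa> h)"
    using cont[of "\<lambda>_. 1"] by simp
  obtain \<alpha> where \<alpha>: "\<alpha> \<in> weights x" "\<forall>\<mu>\<in>weights x. sum \<mu> atoms \<le> sum \<alpha> atoms"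
    using continuous_attains_sup[OF compact_weights weights_nonempty[OF assms]
        continuous_on_subset[OF cont1 subset_UNIV]] by blast
  define W where "W = weights x \<inter> {\<mu>. sum \<mu> atoms = sum \<alpha> atoms}"
  have "closed {\<mu> :: int^'n \<Rightarrow> real. sum \<mu> atoms = sum \<alpha> atoms}"
    by (intro closed_Collect_eq cont1 continuous_intros)
  then have "compact W"
    unfolding W_def by (intro compact_Int_closed compact_weights)
  moreover have "W \<noteq> {}"
    using \<alpha> by (auto simp: W_def)
  ultimately obtain \<beta> where \<beta>: "\<beta> \<in> W"
      "\<forall>\<mu>\<in>W. (\<Sum>h\<in>atoms. \<beta> h * sq_slack h) \<le> (\<Sum>h\<in>atoms. \<mu> h * sq_slack h)"
    using continuous_attains_inf[OF _ _ continuous_on_subset[OF cont subset_UNIV]] by meson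
  define P where "P \<mu> \<longleftrightarrow> \<mu> \<in> W \<and>
      (\<Sum>h\<in>atoms. \<mu> h * sq_slack h) = (\<Sum>h\<in>atoms. \<beta> h * sq_slack h)" for \<mu>
  have "P \<beta>"
    using \<beta>(1) by (simp add: P_def)
  then obtain \<kappa> where "P \<kappa>" "\<And>\<mu>. P \<mu> \<Longrightarrow> card {h. \<kappa> h \<noteq> 0} \<le> card {h. \<mu> h \<noteq> 0}"
    using ex_has_least_nat[of P \<beta> "\<lambda>\<mu>. card {h. \<mu> h \<noteq> 0}"] by blast
  then show thesis
    using \<alpha> \<beta> by (intro that[of \<kappa>]) (auto simp: P_def W_def)
qed

text \<open>The ratio test of the simplex method: \<open>\<delta>\<close> is followed until the
  first decreasing weight reaches 0, and that atom leaves the support.\<close>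

lemma weights_perturb:
  fixes \<delta> :: "int^'n \<Rightarrow> real"
  assumes \<kappa>: "\<kappa> \<in> weights x"
    and \<delta>: "\<And>i. (\<Sum>h\<in>atoms. \<delta> h * slack i h) = 0" "\<And>h. h \<notin> atoms \<Longrightarrow> \<delta> h = 0"
      "\<And>h. \<kappa> h = 0 \<Longrightarrow> 0 \<le> \<delta> h"
  shows "\<exists>\<epsilon>>0. (\<lambda>h. \<kappa> h + \<epsilon> * \<delta> h) \<in> weights x \<and>
    ((\<exists>h. \<delta> h < 0) \<longrightarrow> (\<exists>h. \<kappa> h \<noteq> 0 \<and> \<kappa> h + \<epsilon> * \<delta> h = 0))"
proof -
  define T where "T = {h. \<delta> h < 0}"
  have "T \<subseteq> atoms"
    using \<delta>(2) by (force simp: T_def)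
  then have "finite T"
    using finite_atoms finite_subset by blast
  have \<kappa>T: "0 < \<kappa> h" if "h \<in> T" for h
    using that \<delta>(3)[of h] weightsD(1)[OF \<kappa>, of h] by (force simp: T_def)
  define \<epsilon> where "\<epsilon> = (if T = {} then 1 else Min ((\<lambda>h. \<kappa> h / - \<delta> h) ` T))"
  have "\<epsilon> \<in> (\<lambda>h. \<kappa> h / - \<delta> h) ` T" if "T \<noteq> {}"
    using that Min_in[of "(\<lambda>h. \<kappa> h / - \<delta> h) ` T"] \<open>finite T\<close> by (simp add: \<epsilon>_def)
  then have tight: "\<exists>h\<in>T. \<epsilon> = \<kappa> h / - \<delta> h" if "T \<noteq> {}"
    using that by blast
  have pos: "0 < \<kappa> h / - \<delta> h" if "h \<in> T" for h
    using \<kappa>T[OF that] that by (intro divide_pos_pos) (auto simp: T_def)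
  have "0 < \<epsilon>"
  proof (cases "T = {}")
    case True
    then show ?thesis by (simp add: \<epsilon>_def)
  next
    case False
    then show ?thesis using tight pos by metis
  qed
  have "0 \<le> \<kappa> h + \<epsilon> * \<delta> h" for h
  proof (cases "h \<in> T")
    case True
    then have "\<epsilon> \<le> \<kappa> h / - \<delta> h"
      using \<open>finite T\<close> by (auto simp: \<epsilon>_def)
    then have "\<epsilon> * - \<delta> h \<le> \<kappa> h"
      using True by (subst (asm) pos_le_divide_eq) (auto simp: T_def)
    then show ?thesis
      by simp
  next
    case False
    then show ?thesis
      using \<open>0 < \<epsilon>\<close> weightsD(1)[OF \<kappa>] by (simp add: T_def)
  qed
  moreover have "(\<Sum>h\<in>atoms. (\<kappa> h + \<epsilon> * \<delta> h) * slack i h) = slack i x" for i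
    using weightsD(3)[OF \<kappa>, of i] \<delta>(1)[of i]
    by (simp add: distrib_right sum.distrib mult.assoc sum_distrib_left[symmetric])
  ultimately have "(\<lambda>h. \<kappa> h + \<epsilon> * \<delta> h) \<in> weights x"
    using weightsD(2)[OF \<kappa>] \<delta>(2) by (simp add: weights_def)
  moreover have "\<exists>h. \<kappa> h \<noteq> 0 \<and> \<kappa> h + \<epsilon> * \<delta> h = 0" if "\<exists>h. \<delta> h < 0"
  proof -
    have "T \<noteq> {}"
      using that by (auto simp: T_def)
    then obtain h where h: "h \<in> T" "\<epsilon> = \<kappa> h / - \<delta> h"
      using tight by blast
    then have "\<kappa> h + \<epsilon> * \<delta> h = 0"
      by (auto simp: T_def)
    then show ?thesis
      using \<kappa>T[OF h(1)] by (intro exI[of _ h]) auto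
  qed
  ultimately show ?thesis
    using \<open>0 < \<epsilon>\<close> by blast
qed

lemma sum_perturb:
  fixes \<kappa> \<delta> f :: "int^'n \<Rightarrow> real"
  shows "(\<Sum>h\<in>atoms. (\<kappa> h + \<epsilon> * \<delta> h) * f h) = (\<Sum>h\<in>atoms. \<kappa> h * f h) + \<epsilon> * (\<Sum>h\<in>atoms. \<delta> h * f h)"
  by (simp add: distrib_right sum.distrib sum_distrib_left mult.assoc)

text \<open>The variance identity: \<open>z\<close> is the mean of \<open>S\<close> under
  \<open>w\<close>, so the mean squared distance to \<open>z\<close> is the mean square minus the
  square of the mean.\<close>

lemma weighted_variance:
  fixes w :: "int^'n \<Rightarrow> real"
  assumes "sum w S = 1" "\<And>i. (\<Sum>h\<in>S. w h * slack i h) = slack i z"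
  shows "(\<Sum>h\<in>S. w h * sq_slack (h - z)) = (\<Sum>h\<in>S. w h * sq_slack h) - sq_slack z"
proof -
  have "(\<Sum>h\<in>S. w h * (real_of_int (slack i (h - z)))\<^sup>2) =
        (\<Sum>h\<in>S. w h * (real_of_int (slack i h))\<^sup>2) - (real_of_int (slack i z))\<^sup>2" for i
  proof -
    have "(\<Sum>h\<in>S. w h * (real_of_int (slack i (h - z)))\<^sup>2) =
        (\<Sum>h\<in>S. w h * (real_of_int (slack i h))\<^sup>2) - 2 * slack i z * (\<Sum>h\<in>S. w h * slack i h)
          + (real_of_int (slack i z))\<^sup>2 * sum w S"
      by (simp add: sum_distrib_left sum.distrib[symmetric] sum_subtractf[symmetric])
         (simp add: power2_eq_square algebra_simps)
    then show ?thesis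
      using assms by (simp add: power2_eq_square)
  qed
  then have "(\<Sum>i\<in>UNIV. \<Sum>h\<in>S. w h * (real_of_int (slack i (h - z)))\<^sup>2) =
        (\<Sum>i\<in>UNIV. \<Sum>h\<in>S. w h * (real_of_int (slack i h))\<^sup>2) - sq_slack z"
    by (simp add: sum_subtractf sq_slack_def)
  then show ?thesis
    by (simp add: sq_slack_def sum_distrib_left sum.swap[of _ UNIV])
qed

lemma sq_slack_nonneg: "0 \<le> sq_slack h"
  by (simp add: sq_slack_def sum_nonneg)

lemma sq_slack_eq_0: "sq_slack h = 0 \<Longrightarrow> h = 0"
  using slack_eqI[of h 0] by (simp add: sq_slack_def sum_nonneg_eq_0_iff)

lemma slack_dependence:
  assumes "finite S" "S \<subseteq> face_points I" "card I < card S"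
  obtains \<delta> :: "int^'n \<Rightarrow> real" where "\<And>i. (\<Sum>h\<in>S. \<delta> h * slack i h) = 0"
    "\<exists>h\<in>S. \<delta> h \<noteq> 0"
proof -
  define \<rho> where "\<rho> h = (\<chi> i. real_of_int (slack i h))" for h
  have "inj \<rho>"
    by (rule injI, rule slack_eqI) (simp add: \<rho>_def vec_eq_iff)
  have "\<rho> h \<in> span ((\<lambda>i. axis i 1) ` I)" if "h \<in> S" for h
  proof -
    have "\<rho> h = (\<Sum>i\<in>I. real_of_int (slack i h) *\<^sub>R axis i 1)"
      using that assms(2) by (auto simp: \<rho>_def vec_eq_iff axis_def face_points_def if_distrib cong: if_cong)
    then show ?thesis
      by (auto intro: span_sum span_scale span_base)
  qed
  then have "\<rho> ` S \<subseteq> span ((\<lambda>i. axis i 1) ` I)"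
    by blast
  moreover have "card ((\<lambda>i. axis i (1::real)) ` I) < card (\<rho> ` S)"
    using assms(3) card_image_le[of I "\<lambda>i. axis i (1::real)"] \<open>inj \<rho>\<close>
    by (simp add: card_image inj_on_subset)
  ultimately have "dependent (\<rho> ` S)"
    using independent_span_bound[of "(\<lambda>i. axis i 1) ` I" "\<rho> ` S"] by fastforce
  then obtain u where u: "\<exists>v\<in>\<rho> ` S. u v \<noteq> 0" "(\<Sum>v\<in>\<rho> ` S. u v *\<^sub>R v) = 0"
    using dependent_finite[of "\<rho> ` S"] assms(1) by blast
  have "(\<Sum>h\<in>S. u (\<rho> h) *\<^sub>R \<rho> h) = 0"
    using u(2) \<open>inj \<rho>\<close> by (simp add: sum.reindex inj_on_subset)
  then have "(\<Sum>h\<in>S. u (\<rho> h) * slack i h) = 0" for i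
    by (drule_tac arg_cong[where f = "\<lambda>v. v $ i"]) (simp add: \<rho>_def)
  then show thesis
    using u(1) by (intro that[of "\<lambda>h. u (\<rho> h)"]) auto
qed

text \<open>Rounding an optimal vertex down leaves a remainder \<open>r\<close>; rounding it up overshoots by a
  cone point \<open>z\<close>. Optimality bounds the number of atoms in \<open>r\<close> by the sum of the fractional parts,
  and forces this sum below \<open>card S - 1\<close> unless \<open>z\<close> is an atom; the quadratic cost excludes the
  latter, as \<open>z\<close> would be a cheaper convex combination of the support.\<close>

theorem short_sum_face:
  assumes x: "x \<in> face_points I"
  shows "short_sum (max 1 (2 * card I - 2)) x"
proof (cases "x = 0")
  case True
  then show ?thesis
    using short_sum_mono[OF short_sum.zero] by simp
next
  case False
  have xc: "x \<in> cone_points"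
    using x by (simp add: face_points_def)
  then obtain \<kappa> where \<kappa>: "\<kappa> \<in> weights x"
    and opt: "\<And>\<mu>. \<mu> \<in> weights x \<Longrightarrow> sum \<mu> atoms \<le> sum \<kappa> atoms"
    and cheap: "\<And>\<mu>. \<mu> \<in> weights x \<Longrightarrow> sum \<mu> atoms = sum \<kappa> atoms \<Longrightarrow>
       (\<Sum>h\<in>atoms. \<kappa> h * sq_slack h) \<le> (\<Sum>h\<in>atoms. \<mu> h * sq_slack h)"
    and small: "\<And>\<mu>. \<mu> \<in> weights x \<Longrightarrow> sum \<mu> atoms = sum \<kappa> atoms \<Longrightarrow>
       (\<Sum>h\<in>atoms. \<mu> h * sq_slack h) = (\<Sum>h\<in>atoms. \<kappa> h * sq_slack h) \<Longrightarrow>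
       card {h. \<kappa> h \<noteq> 0} \<le> card {h. \<mu> h \<noteq> 0}"
    using optimal_weights by blast
  define S where "S = {h. \<kappa> h \<noteq> 0}"
  have "S \<subseteq> atoms"
    using weightsD(2)[OF \<kappa>] by (auto simp: S_def)
  then have "finite S"
    using finite_atoms finite_subset by blast
  have sum_S: "(\<Sum>h\<in>atoms. f h) = (\<Sum>h\<in>S. f h)" if "\<And>h. h \<notin> S \<Longrightarrow> f h = 0" for f :: "int^'n \<Rightarrow> real"
    using that \<open>S \<subseteq> atoms\<close> by (intro sum.mono_neutral_right finite_atoms) auto
  have \<kappa>_slack: "(\<Sum>h\<in>S. \<kappa> h * slack i h) = slack i x" for i
    using weightsD(3)[OF \<kappa>, of i] sum_S[of "\<lambda>h. \<kappa> h * slack i h"] by (simp add: S_def)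
  have "S \<noteq> {}"
    using \<kappa>_slack False slack_eqI[of x 0] by auto
  \<comment> \<open>First-order optimality: a feasible direction cannot raise the total weight, and
    if it preserves it, it cannot lower the quadratic cost.\<close>
  have direction: "sum \<delta> atoms < 0 \<or> sum \<delta> atoms = 0 \<and> 0 \<le> (\<Sum>h\<in>atoms. \<delta> h * sq_slack h)"
    if \<delta>: "\<And>i. (\<Sum>h\<in>atoms. \<delta> h * slack i h) = 0" "\<And>h. h \<notin> atoms \<Longrightarrow> \<delta> h = 0"
      "\<And>h. h \<notin> S \<Longrightarrow> 0 \<le> \<delta> h" for \<delta> :: "int^'n \<Rightarrow> real"
  proof -
    have "0 \<le> \<delta> h" if "\<kappa> h = 0" for h
      using \<delta>(3)[of h] that by (simp add: S_def)
    then obtain \<epsilon> where \<epsilon>: "0 < \<epsilon>" "(\<lambda>h. \<kappa> h + \<epsilon> * \<delta> h) \<in> weights x"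
      using weights_perturb[OF \<kappa> \<delta>(1,2)] by blast
    have "\<epsilon> * sum \<delta> atoms \<le> 0"
      using opt[OF \<epsilon>(2)] by (simp add: sum.distrib sum_distrib_left)
    moreover have "0 \<le> \<epsilon> * (\<Sum>h\<in>atoms. \<delta> h * sq_slack h)" if "sum \<delta> atoms = 0"
      using cheap[OF \<epsilon>(2)] that unfolding sum_perturb
      by (simp add: sum.distrib sum_distrib_left[symmetric])
    ultimately show ?thesis
      using \<epsilon>(1) by (auto simp: mult_le_0_iff zero_le_mult_iff)
  qed
  have S_face: "S \<subseteq> face_points I"
  proof
    fix h assume h: "h \<in> S"
    have "slack i h = 0" if "i \<notin> I" for i
    proof -
      have "(\<Sum>h\<in>S. \<kappa> h * slack i h) = 0"
        using x that by (simp add: \<kappa>_slack face_points_def)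
      then have "\<kappa> h * slack i h = 0"
        using \<open>finite S\<close> h \<open>S \<subseteq> atoms\<close> weightsD(1)[OF \<kappa>] real_slack_nonneg
        by (subst (asm) sum_nonneg_eq_0_iff) auto
      then show ?thesis
        using h by (simp add: S_def)
    qed
    then show "h \<in> face_points I"
      using h \<open>S \<subseteq> atoms\<close> atoms_cone by (auto simp: face_points_def)
  qed
  have "card S \<le> card I"
  proof (rule ccontr)
    assume "\<not> card S \<le> card I"
    then obtain \<delta>0 :: "int^'n \<Rightarrow> real" where \<delta>0: "\<And>i. (\<Sum>h\<in>S. \<delta>0 h * slack i h) = 0"
        "\<exists>h\<in>S. \<delta>0 h \<noteq> 0"
      using slack_dependence[OF \<open>finite S\<close> S_face] by auto
    \<comment> \<open>The sign guarantees a negative entry of \<open>\<delta>\<close>. As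
      \<open>\<delta>\<close> and its negative are both feasible directions, both objectives are
      constant along \<open>\<delta>\<close>, and moving until an atom drops out contradicts the
      minimal support.\<close>
    define s :: real where "s = (if \<exists>h\<in>S. \<delta>0 h < 0 then 1 else -1)"
    define \<delta> where "\<delta> h = (if h \<in> S then s * \<delta>0 h else 0)" for h
    have \<delta>: "(\<Sum>h\<in>atoms. \<delta> h * slack i h) = 0" for i
      using \<delta>0(1)[of i] sum_S[of "\<lambda>h. \<delta> h * slack i h"]
      by (simp add: \<delta>_def mult.assoc sum_distrib_left[symmetric])
    have "\<exists>h. \<delta> h < 0"
      using \<delta>0(2) by (force simp: \<delta>_def s_def not_less)
    have \<delta>off: "\<delta> h = 0" if "h \<notin> S" for h
      using that by (simp add: \<delta>_def)
    have "sum (\<lambda>h. - \<delta> h) atoms < 0 \<or> sum (\<lambda>h. - \<delta> h) atoms = 0 \<and> 0 \<le> (\<Sum>h\<in>atoms. - \<delta> h * sq_slack h)"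
      using \<delta> \<delta>off \<open>S \<subseteq> atoms\<close> by (intro direction) (auto simp: sum_negf)
    moreover have "sum \<delta> atoms < 0 \<or> sum \<delta> atoms = 0 \<and> 0 \<le> (\<Sum>h\<in>atoms. \<delta> h * sq_slack h)"
      using \<delta> \<delta>off \<open>S \<subseteq> atoms\<close> by (intro direction) auto
    ultimately have zero: "sum \<delta> atoms = 0" "(\<Sum>h\<in>atoms. \<delta> h * sq_slack h) = 0"
      by (auto simp: sum_negf)
    have "\<And>h. h \<notin> atoms \<Longrightarrow> \<delta> h = 0" "\<And>h. \<kappa> h = 0 \<Longrightarrow> 0 \<le> \<delta> h"
      using \<delta>off \<open>S \<subseteq> atoms\<close> by (auto simp: S_def)
    then obtain \<epsilon> g where \<epsilon>: "(\<lambda>h. \<kappa> h + \<epsilon> * \<delta> h) \<in> weights x" and g: "\<kappa> g \<noteq> 0" "\<kappa> g + \<epsilon> * \<delta> g = 0"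
      using weights_perturb[OF \<kappa> \<delta>] \<open>\<exists>h. \<delta> h < 0\<close> by blast
    have "card S \<le> card {h. \<kappa> h + \<epsilon> * \<delta> h \<noteq> 0}"
      unfolding S_def using small[OF \<epsilon>] zero
      by (simp add: sum_perturb) (simp add: sum.distrib sum_distrib_left[symmetric])
    moreover have "{h. \<kappa> h + \<epsilon> * \<delta> h \<noteq> 0} \<subset> S"
      using g \<delta>off by (auto simp: S_def)
    ultimately show False
      using psubset_card_mono[OF \<open>finite S\<close>] leD by blast
  qed
  define fl where "fl h = nat \<lfloor>\<kappa> h\<rfloor>" for h
  \<comment> \<open>\<open>Suc (fl h)\<close> exceeds \<open>\<kappa> h\<close> even when that is an
    integer, so every \<open>w h\<close> is positive; this makes \<open>z\<close> nonzero.\<close>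
  define w where "w h = 1 - frac (\<kappa> h)" for h
  have fl: "real (fl h) = \<kappa> h - frac (\<kappa> h)" "int (fl h) = \<lfloor>\<kappa> h\<rfloor>" for h
    using weightsD(1)[OF \<kappa>, of h] by (simp_all add: fl_def frac_def)
  have w: "0 < w h" for h
    by (simp add: w_def frac_lt_1)
  define r where "r = x - (\<Sum>h\<in>S. int (fl h) *s h)"
  define z where "z = (\<Sum>h\<in>S. int (Suc (fl h)) *s h) - x"
  have r_slack: "real_of_int (slack i r) = (\<Sum>h\<in>S. frac (\<kappa> h) * slack i h)" for i
    by (simp add: r_def \<kappa>_slack[symmetric] sum_subtractf[symmetric] left_diff_distrib[symmetric] fl
        del: of_int_of_nat_eq of_nat_Suc) (simp add: algebra_simps frac_def)
  have z_slack: "real_of_int (slack i z) = (\<Sum>h\<in>S. w h * slack i h)" for i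
    by (simp add: z_def \<kappa>_slack[symmetric] sum_subtractf[symmetric] left_diff_distrib[symmetric] fl)
       (simp add: algebra_simps frac_def w_def)
  have "r \<in> cone_points"
  proof -
    have "0 \<le> real_of_int (slack i r)" for i
      unfolding r_slack using \<open>S \<subseteq> atoms\<close> by (intro sum_nonneg mult_nonneg_nonneg real_slack_nonneg) auto
    then show ?thesis
      by (simp add: cone_points_def)
  qed
  then obtain \<mu> :: "int^'n \<Rightarrow> nat" where \<mu>: "r = (\<Sum>h\<in>atoms. int (\<mu> h) *s h)"
    using atom_combination by blast
  have w_slack: "0 \<le> w h * slack i h" if "h \<in> S" for h i
    using that \<open>S \<subseteq> atoms\<close> w[of h] real_slack_nonneg[of h i] by (intro mult_nonneg_nonneg) auto
  have "z \<in> cone_points"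
  proof -
    have "0 \<le> real_of_int (slack i z)" for i
      unfolding z_slack by (intro sum_nonneg w_slack)
    then show ?thesis
      by (simp add: cone_points_def)
  qed
  then obtain \<nu> :: "int^'n \<Rightarrow> nat" where \<nu>: "z = (\<Sum>h\<in>atoms. int (\<nu> h) *s h)"
    using atom_combination by blast
  have "z \<noteq> 0"
  proof
    assume "z = 0"
    obtain h where h: "h \<in> S"
      using \<open>S \<noteq> {}\<close> by blast
    have "slack i h = 0" for i
    proof -
      have "(\<Sum>h\<in>S. w h * slack i h) = 0"
        using z_slack[of i] \<open>z = 0\<close> by simp
      then have "w h * slack i h = 0"
        using \<open>finite S\<close> h w_slack by (subst (asm) sum_nonneg_eq_0_iff) auto
      then show ?thesis
        using w[of h] by simp
    qed
    then have "h = 0"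
      by (intro slack_eqI) simp
    then show False
      using h \<open>S \<subseteq> atoms\<close> zero_notin_atoms by blast
  qed
  \<comment> \<open>Replacing the fractional parts by the decomposition of \<open>r\<close> gives
    another member of \<open>weights x\<close>, whose total is at most the optimum.\<close>
  have \<mu>_le: "real (sum \<mu> atoms) \<le> (\<Sum>h\<in>S. frac (\<kappa> h))"
  proof -
    have "(\<lambda>h. if h \<in> atoms then real (fl h) + real (\<mu> h) else 0) \<in> weights x"
    proof -
      have "(\<Sum>h\<in>atoms. (real (fl h) + real (\<mu> h)) * slack i h) = slack i x" for i
      proof -
        have "(\<Sum>h\<in>atoms. real (fl h) * slack i h) = (\<Sum>h\<in>S. real (fl h) * slack i h)"
          by (rule sum_S) (simp add: S_def fl_def)
        then show ?thesis
          using real_slack_combination[OF \<mu>, of i] r_slack[of i]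
          by (simp add: distrib_right sum.distrib \<kappa>_slack[symmetric] fl(1) left_diff_distrib sum_subtractf)
      qed
      then show ?thesis
        by (simp add: weights_def)
    qed
    from opt[OF this] have "(\<Sum>h\<in>atoms. real (fl h)) + real (sum \<mu> atoms) \<le> sum \<kappa> atoms"
      by (simp add: sum.distrib)
    then show ?thesis
      using sum_S[of \<kappa>] sum_S[of "\<lambda>h. real (fl h)"] by (simp add: S_def fl_def) (simp add: S_def[symmetric] fl(1)[unfolded fl_def] sum_subtractf)
  qed
  \<comment> \<open>This direction exchanges the combination \<open>w\<close> of \<open>S\<close>
    for the decomposition \<open>\<nu>\<close> of \<open>z\<close>; it can be negative only on
    \<open>S\<close>, hence is feasible.\<close>
  define \<delta> where "\<delta> h = real (if h \<in> atoms then \<nu> h else 0) - (if h \<in> S then w h else 0)" for h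
  have sum_\<delta>: "(\<Sum>h\<in>atoms. \<delta> h * f h) = (\<Sum>h\<in>atoms. real (\<nu> h) * f h) - (\<Sum>h\<in>S. w h * f h)"
    for f :: "int^'n \<Rightarrow> real"
    using sum_S[of "\<lambda>h. (if h \<in> S then w h else 0) * f h"]
    by (simp add: \<delta>_def left_diff_distrib sum_subtractf)
  have dir: "sum \<delta> atoms < 0 \<or> sum \<delta> atoms = 0 \<and> 0 \<le> (\<Sum>h\<in>atoms. \<delta> h * sq_slack h)"
  proof (rule direction)
    show "(\<Sum>h\<in>atoms. \<delta> h * slack i h) = 0" for i
      unfolding sum_\<delta> using real_slack_combination[OF \<nu>, of i] z_slack[of i] by simp
  qed (use \<open>S \<subseteq> atoms\<close> in \<open>auto simp: \<delta>_def\<close>)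
  have sum\<delta>: "sum \<delta> atoms = real (sum \<nu> atoms) - sum w S"
    using sum_\<delta>[of "\<lambda>_. 1"] by simp
  have sum_w: "sum w S = real (card S) - (\<Sum>h\<in>S. frac (\<kappa> h))"
    by (simp add: w_def sum_subtractf)
  have "sum \<nu> atoms \<noteq> 0"
  proof
    assume "sum \<nu> atoms = 0"
    then have "z = 0"
      by (subst \<nu>) (simp add: finite_atoms)
    then show False
      using \<open>z \<noteq> 0\<close> by simp
  qed
  have total: "short_sum (card S + sum \<mu> atoms) x"
  proof -
    have "short_sum (card S) (\<Sum>h\<in>S. int (fl h) *s h)"
      by (rule short_sum_mono[OF short_sum_combination[OF \<open>finite S\<close> \<open>S \<subseteq> atoms\<close>]])
         (simp add: card_mono \<open>finite S\<close>)
    moreover have "short_sum (sum \<mu> atoms) r"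
      unfolding \<mu> by (intro short_sum_le_sum finite_atoms) auto
    ultimately have "short_sum (card S + sum \<mu> atoms) ((\<Sum>h\<in>S. int (fl h) *s h) + r)"
      by (rule short_sum_add)
    then show ?thesis
      by (simp add: r_def)
  qed
  show ?thesis
  \<comment> \<open>For \<open>card S = 1\<close> the bound \<open>2 * card S - 2\<close> is 0,
    which is why the second alternative and the \<open>max 1\<close> in the statement occur.\<close>
  proof (cases "card S + sum \<mu> atoms \<le> 2 * card S - 2 \<or> card S = 1 \<and> sum \<mu> atoms = 0")
    case True
    then show ?thesis
      using \<open>card S \<le> card I\<close> by (intro short_sum_mono[OF total]) auto
  next
    case False
    \<comment> \<open>The two optimality bounds combine through \<open>sum_w\<close>. As
      \<open>z\<close> needs at least one atom, the only remaining case is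
      \<open>sum \<nu> atoms = 1\<close> with \<open>sum \<mu> atoms + 1 = card S\<close>.\<close>
    have "real (sum \<mu> atoms) \<le> real (card S) - real (sum \<nu> atoms)"
      using \<mu>_le dir sum\<delta> sum_w by linarith
    moreover have "1 \<le> real (sum \<nu> atoms)"
      using \<open>sum \<nu> atoms \<noteq> 0\<close> by linarith
    ultimately have tight: "sum \<nu> atoms = 1" "sum \<mu> atoms + 1 = card S"
      using False by linarith+
    have "sum w S = 1"
      using dir sum\<delta> sum_w \<mu>_le tight by linarith
    then have "0 \<le> (\<Sum>h\<in>atoms. \<delta> h * sq_slack h)"
      using dir sum\<delta> tight by linarith
    obtain a where a: "a \<in> atoms" "\<nu> a = 1" "\<forall>h\<in>atoms. h \<noteq> a \<longrightarrow> \<nu> h = 0"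
      using tight(1) sum_eq_1_iff[OF finite_atoms, of \<nu>] by auto
    have \<nu>_sum: "(\<Sum>h\<in>atoms. real (\<nu> h) * f h) = f a" for f :: "int^'n \<Rightarrow> real"
    proof -
      have "(\<Sum>h\<in>atoms. real (\<nu> h) * f h) = (\<Sum>h\<in>atoms. if h = a then f h else 0)"
        using a by (intro sum.cong) auto
      then show ?thesis
        using a(1) by (simp add: finite_atoms)
    qed
    have "slack i z = slack i a" for i
      using real_slack_combination[OF \<nu>, of i] \<nu>_sum[of "\<lambda>h. slack i h"] by simp
    then have "z = a"
      by (rule slack_eqI)
    \<comment> \<open>By optimality the atom \<open>z\<close> is not cheaper than the combination
      \<open>w\<close> of which it is the mean. So the variance vanishes and \<open>S\<close>
      collapses to \<open>z\<close>.\<close>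
    have "(\<Sum>h\<in>S. w h * sq_slack (h - z)) \<le> 0"
      using weighted_variance[OF \<open>sum w S = 1\<close> z_slack[symmetric]]
        \<open>0 \<le> (\<Sum>h\<in>atoms. \<delta> h * sq_slack h)\<close>
      unfolding sum_\<delta> \<nu>_sum \<open>z = a\<close> by simp
    moreover have nn: "0 \<le> w h * sq_slack (h - z)" for h
      using w[of h] sq_slack_nonneg[of "h - z"] by simp
    ultimately have "(\<Sum>h\<in>S. w h * sq_slack (h - z)) = 0"
      by (intro antisym sum_nonneg) auto
    then have var0: "w h * sq_slack (h - z) = 0" if "h \<in> S" for h
      using that \<open>finite S\<close> nn by (subst (asm) sum_nonneg_eq_0_iff) auto
    have "h = z" if "h \<in> S" for h
      using var0[OF that] w[of h] sq_slack_eq_0[of "h - z"] by auto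
    then have "S = {z}"
      using \<open>S \<noteq> {}\<close> by blast
    then have "card S = 1"
      by simp
    then show ?thesis
      using False tight by simp
  qed
qed

section \<open>Bounds for the number of atoms\<close>

text \<open>Modulo the column lattice these vectors are the subset sums of the classes of the unit
  vectors.\<close>

definition ind :: "'n set \<Rightarrow> int^'n" where
  "ind J = (\<chi> i. if i \<in> J then 1 else 0)"

lemma ind_inject [simp]: "ind J = ind J' \<longleftrightarrow> J = J'"
  by (auto simp: ind_def vec_eq_iff split: if_splits)

lemma ind_singleton: "ind {i} = axis i 1"
  by (auto simp: ind_def vec_eq_iff axis_def)

lemma ind_diff: "J \<subseteq> J' \<Longrightarrow> ind J' - ind J = ind (J' - J)"
  by (auto simp: ind_def vec_eq_iff)

text \<open>Stated for all faces, so that a reduction, which trades one coordinate for one atom, can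
  use the induction hypothesis. If none applies, the empty set and the singletons give
  \<open>card I + 1\<close> incongruent vectors, so \<open>card I < D\<close>; for \<open>D\<close>
  at least 5, \<open>2 * card I - 2\<close> is then at most \<open>card I + (D - 3)\<close>.\<close>

lemma short_sum_cone_face:
  defines "D \<equiv> nat \<bar>det A\<bar>"
  assumes "x \<in> face_points I"
  shows "short_sum (card I + (if D \<le> 4 then 0 else D - 3)) x"
  using finite[of I] assms(2)
proof (induction I arbitrary: x rule: finite_psubset_induct)
  case (psubset I)
  define K where "K = (if D \<le> 4 then 0 else D - 3)"
  have IH: "short_sum (card I - 1 + K) y" if "j \<in> I" "y \<in> face_points (I - {j})" for j y
  proof -
    have "I - {j} \<subset> I" "card (I - {j}) = card I - 1"
      using that(1) by auto
    then show ?thesis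
      using psubset.IH[of "I - {j}" y] that(2) by (simp only: K_def)
  qed
  have goal: "short_sum (card I + K) x" if "short_sum (Suc (card I - 1 + K)) x" "I \<noteq> {}"
    using that by (cases "card I") auto
  consider (zero_one) u where "u \<in> face_points I" "u \<noteq> 0" "\<And>i. slack i u \<le> 1"
    | (shift) i j where "i \<in> I" "j \<in> I" "i \<noteq> j" "lattice_cong A (ind {i}) (ind {j})"
    | (free) "\<And>u. u \<in> face_points I \<Longrightarrow> u \<noteq> 0 \<Longrightarrow> \<exists>i. 1 < slack i u"
        "\<And>i j. i \<in> I \<Longrightarrow> j \<in> I \<Longrightarrow> i \<noteq> j \<Longrightarrow> \<not> lattice_cong A (ind {i}) (ind {j})"
    by (metis not_less)
  then have "short_sum (card I + K) x"
  proof cases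
    case zero_one
    then have "I \<noteq> {}"
      by auto
    moreover have "short_sum (Suc (card I - 1 + K)) x"
      by (rule reduce_zero_one[OF zero_one _ psubset.prems]) (rule IH)
    ultimately show ?thesis
      by (intro goal)
  next
    case shift
    then obtain d where d: "A *v d = axis i 1 - axis j 1"
      by (auto simp: lattice_cong_def ind_singleton)
    have "short_sum (Suc (card I - 1 + K)) x"
      by (rule reduce_shift[OF \<open>i \<noteq> j\<close> d _ \<open>i \<in> I\<close> psubset.prems]) (rule IH[OF \<open>j \<in> I\<close>])
    then show ?thesis
      using \<open>i \<in> I\<close> by (intro goal) auto
  next
    case free
    \<comment> \<open>A congruence would give a lattice point with slack vector
      \<open>ind (J' - J)\<close>, a nonzero zero-one point of the face, which this case
      excludes.\<close>
    have subset_incong: "\<not> lattice_cong A (ind J') (ind J)" if J: "J \<subset> J'" "J' \<subseteq> I" for J J'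
    proof
      assume "lattice_cong A (ind J') (ind J)"
      then have "ind (J' - J) \<in> range ((*v) A)"
        using J by (simp add: lattice_cong_def ind_diff psubset_imp_subset)
      then obtain u where u: "A *v u = ind (J' - J)"
        by (metis imageE)
      then have su: "slack i u = (if i \<in> J' - J then 1 else 0)" for i
        by (simp add: slack_def ind_def)
      have "u \<noteq> 0"
      proof
        assume "u = 0"
        then have "ind (J' - J) = 0"
          using u by simp
        also have "0 = ind {}"
          by (simp add: ind_def vec_eq_iff)
        finally show False
          using J by auto
      qed
      moreover have "u \<in> face_points I"
        using J by (auto simp: face_points_def cone_points_def su)
      ultimately obtain i where "1 < slack i u"
        using free(1) by blast
      then show False
        by (simp add: su split: if_splits)
    qed
    have family: "card F \<le> D"
      if F: "\<And>J. J \<in> F \<Longrightarrow> J \<subseteq> I"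
        and chain: "\<And>J J'. J \<in> F \<Longrightarrow> J' \<in> F \<Longrightarrow>
          J \<subseteq> J' \<or> J' \<subseteq> J \<or> (\<exists>i\<in>I. \<exists>j\<in>I. i \<noteq> j \<and> J = {i} \<and> J' = {j})" for F
    proof -
      have "\<not> lattice_cong A (ind J) (ind J')" if J: "J \<in> F" "J' \<in> F" "J \<noteq> J'" for J J'
      proof
        assume cong: "lattice_cong A (ind J) (ind J')"
        consider "J \<subset> J'" | "J' \<subset> J" | i j where "i \<in> I" "j \<in> I" "i \<noteq> j" "J = {i}" "J' = {j}"
          using chain[OF J(1,2)] J(3) by blast
        then show False
        proof cases
          case 1
          then show False
            using subset_incong F[OF J(2)] lattice_cong_sym[OF cong] by blast
        next
          case 2
          then show False
            using subset_incong F[OF J(1)] cong by blast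
        next
          case 3
          then show False
            using free(2) cong by blast
        qed
      qed
      then have "pairwise (\<lambda>v w. \<not> lattice_cong A v w) (ind ` F)"
        by (auto simp: pairwise_def)
      then have "int (card (ind ` F)) \<le> \<bar>det A\<bar>"
        by (intro card_incongruent_le_det det_nonzero) auto
      moreover have "card (ind ` F) = card F"
        by (intro card_image inj_onI) simp
      ultimately show ?thesis
        by (simp add: D_def)
    qed
    have "card (insert {} ((\<lambda>i. {i}) ` I)) \<le> D"
      by (rule family) auto
    then have "card I + 1 \<le> D"
      by (subst (asm) card_insert_disjoint) (auto simp: card_image)
    have "\<not> (card I = 3 \<and> D = 4)"
    proof
      assume *: "card I = 3 \<and> D = 4"
      then obtain a b c where abc: "I = {a, b, c}" "a \<noteq> b" "a \<noteq> c" "b \<noteq> c"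
        by (auto simp: card_3_iff)
      \<comment> \<open>Any two of these five sets are nested, except the two singletons, so they
        give five classes where only four exist.\<close>
      have "card {{}, {a}, {b}, {a, b}, {a, b, c}} \<le> D"
        by (rule family) (use abc in auto)
      moreover have "card {{}, {a}, {b}, {a, b}, {a, b, c}} = 5"
        using abc by (auto simp: card_insert_if)
      ultimately show False
        using * by simp
    qed
    show ?thesis
    proof (cases "I = {}")
      case True
      then show ?thesis
        using psubset.prems short_sum_mono[OF short_sum.zero] by simp
    next
      case False
      then have "0 < card I"
        by (simp add: card_gt_0_iff)
      then have "max 1 (2 * card I - 2) \<le> card I + K"
        using \<open>card I + 1 \<le> D\<close> \<open>\<not> (card I = 3 \<and> D = 4)\<close> unfolding K_def by (cases "D \<le> 4") auto
      then show ?thesis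
        using short_sum_mono short_sum_face[OF psubset.prems] by blast
    qed
  qed
  then show ?case
    by (simp add: K_def)
qed

section \<open>The lower bound through a generic lattice point\<close>

lemma exists_normal_vector:
  fixes T :: "(int^'n) set"
  assumes "finite T" "card T < CARD('n)"
  obtains a :: "real^'n" where "a \<noteq> 0" "\<And>h. h \<in> T \<Longrightarrow> (\<Sum>i\<in>UNIV. a $ i * slack i h) = 0"
proof -
  define \<rho> where "\<rho> h = (\<chi> i. real_of_int (slack i h))" for h
  have "dim (\<rho> ` T) \<le> card (\<rho> ` T)"
    using assms(1) by (intro dim_le_card') simp
  also have "\<dots> \<le> card T"
    using assms(1) by (rule card_image_le)
  finally have "dim (\<rho> ` T) < DIM(real^'n)"
    using assms(2) by simp
  then obtain a where a: "a \<noteq> 0" "\<And>y. y \<in> span (\<rho> ` T) \<Longrightarrow> orthogonal a y"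
    using orthogonal_to_subspace_exists by blast
  have "(\<Sum>i\<in>UNIV. a $ i * slack i h) = 0" if "h \<in> T" for h
    using a(2)[of "\<rho> h"] that by (auto simp: orthogonal_def inner_vec_def \<rho>_def intro: span_base)
  then show thesis
    using a(1) that by blast
qed

text \<open>The witness lies on a moment curve, which meets each hyperplane in finitely many points.\<close>

lemma generic_cone_point:
  fixes N :: "(real^'n) set"
  assumes "finite N" "0 \<notin> N"
  obtains x where "x \<in> cone_points" "\<And>a. a \<in> N \<Longrightarrow> (\<Sum>i\<in>UNIV. a $ i * slack i x) \<noteq> 0"
proof -
  \<comment> \<open>Distinct exponents keep the entries of \<open>a\<close> apart as coefficients of
    \<open>p a\<close>, so a nonzero \<open>a\<close> gives a nonzero polynomial.\<close>
  obtain e :: "'n \<Rightarrow> nat" where e: "inj e"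
    using finite_imp_inj_to_nat_seg[of "UNIV :: 'n set"] by auto
  define p where "p a = (\<Sum>i\<in>UNIV. monom (a $ i) (e i))" for a :: "real^'n"
  have "p a \<noteq> 0" if a: "a \<in> N" for a
  proof -
    obtain k where k: "a $ k \<noteq> 0"
      using assms(2) a by (metis vec_eq_iff zero_index)
    have "coeff (p a) (e k) = (\<Sum>i\<in>UNIV. if i = k then a $ i else 0)"
      unfolding p_def coeff_sum by (intro sum.cong) (auto simp: inj_eq[OF e])
    then have "coeff (p a) (e k) = a $ k"
      by simp
    then show ?thesis
      using k by auto
  qed
  then have "finite (\<Union>a\<in>N. {t. poly (p a) t = 0})"
    using assms(1) by (auto simp: poly_roots_finite)
  then have "finite ((\<lambda>t. real t) -` (\<Union>a\<in>N. {t. poly (p a) t = 0}))"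
    by (rule finite_vimageI) (auto intro: injI)
  then obtain t :: nat where t: "t \<notin> (\<lambda>t. real t) -` (\<Union>a\<in>N. {t. poly (p a) t = 0})"
    using ex_new_if_finite infinite_UNIV_nat by metis
  have "\<forall>i. \<exists>u. \<forall>k. slack k u = (if k = i then \<bar>det A\<bar> else 0)"
    using axis_multiple by metis
  then obtain u where u: "slack k (u i) = (if k = i then \<bar>det A\<bar> else 0)" for i k
    by metis
  define x where "x = (\<Sum>i\<in>UNIV. int t ^ e i *s u i)"
  have x: "slack k x = \<bar>det A\<bar> * int t ^ e k" for k
    by (simp add: x_def u if_distrib mult.commute cong: if_cong)
  have "(\<Sum>i\<in>UNIV. a $ i * slack i x) = \<bar>det A\<bar> * poly (p a) (real t)" for a
    by (simp add: x p_def poly_sum poly_monom sum_distrib_left mult_ac)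
  then have "(\<Sum>i\<in>UNIV. a $ i * slack i x) \<noteq> 0" if "a \<in> N" for a
    using t that det_nonzero by auto
  moreover have "x \<in> cone_points"
    by (simp add: cone_points_def x)
  ultimately show thesis
    using that by blast
qed

text \<open>Fewer than \<open>CARD('n)\<close> atoms have slack vectors in a common hyperplane, and
  there are finitely many sets of atoms. A cone point off all chosen hyperplanes is no combination
  of so few atoms.\<close>

lemma long_cone_point:
  obtains x where "x \<in> cone_points"
    "\<And>l h c. (\<forall>i<l. h i \<in> atoms) \<Longrightarrow> x = (\<Sum>i<l. int (c i) *s h i) \<Longrightarrow> CARD('n) \<le> l"
proof -
  define \<T> where "\<T> = {T. T \<subseteq> atoms \<and> card T < CARD('n)}"
  have "\<forall>T\<in>\<T>. \<exists>a :: real^'n. a \<noteq> 0 \<and> (\<forall>h\<in>T. (\<Sum>i\<in>UNIV. a $ i * slack i h) = 0)"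
  proof
    fix T assume "T \<in> \<T>"
    then have "finite T" "card T < CARD('n)"
      using finite_atoms finite_subset by (auto simp: \<T>_def)
    then show "\<exists>a :: real^'n. a \<noteq> 0 \<and> (\<forall>h\<in>T. (\<Sum>i\<in>UNIV. a $ i * slack i h) = 0)"
      using exists_normal_vector by metis
  qed
  then obtain a where a: "\<And>T. T \<in> \<T> \<Longrightarrow> a T \<noteq> (0 :: real^'n)"
      "\<And>T h. T \<in> \<T> \<Longrightarrow> h \<in> T \<Longrightarrow> (\<Sum>i\<in>UNIV. a T $ i * slack i h) = 0"
    by metis
  have "finite (a ` \<T>)"
    using finite_atoms by (auto simp: \<T>_def)
  moreover have "0 \<notin> a ` \<T>"
    using a(1) by force
  ultimately obtain x where x: "x \<in> cone_points" "\<And>b. b \<in> a ` \<T> \<Longrightarrow> (\<Sum>i\<in>UNIV. b $ i * slack i x) \<noteq> 0"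
    using generic_cone_point by blast
  have "CARD('n) \<le> l"
    if h: "\<forall>i<l. h i \<in> atoms" and xh: "x = (\<Sum>i<l. int (c i) *s h i)"
    for l and h :: "nat \<Rightarrow> int^'n" and c :: "nat \<Rightarrow> nat"
  proof (rule ccontr)
    assume "\<not> CARD('n) \<le> l"
    moreover have "card (h ` {..<l}) \<le> l"
      using card_image_le[of "{..<l}" h] by simp
    ultimately have T: "h ` {..<l} \<in> \<T>"
      using h by (auto simp: \<T>_def)
    define b where "b = a (h ` {..<l})"
    have "(\<Sum>i\<in>UNIV. b $ i * slack i x) = (\<Sum>j<l. c j * (\<Sum>i\<in>UNIV. b $ i * slack i (h j)))"
      by (subst xh) (simp add: sum_distrib_left sum.swap[of _ _ "{..<l}"] mult_ac)
    also have "\<dots> = 0"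
      using a(2)[OF T] by (simp add: b_def)
    finally show False
      using x(2)[of b] T by (simp add: b_def)
  qed
  then show thesis
    using that x(1) by blast
qed

section \<open>The Hilbert basis\<close>

lemma matrix_cone_integer_points: "matrix_cone A \<inter> integer_points = real_vec ` cone_points"
proof -
  have mem: "real_vec v \<in> matrix_cone A \<longleftrightarrow> v \<in> cone_points" for v
    unfolding matrix_cone_def real_mat_def[symmetric]
    by (simp add: real_mat_mult_vec cone_points_def slack_def)
  have pts: "integer_points = range (real_vec :: int^'n \<Rightarrow> real^'n)"
  proof (intro set_eqI iffI)
    fix x :: "real^'n" assume "x \<in> integer_points"
    then have "x = real_vec (\<chi> i. \<lfloor>x $ i\<rfloor>)"
      by (simp add: integer_points_def vec_eq_iff of_int_floor_cancel)
    then show "x \<in> range real_vec"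
      by blast
  qed (auto simp: integer_points_def)
  show ?thesis
    unfolding pts using mem by auto
qed

lemma real_vec_combination:
  "real_vec (\<Sum>i\<in>S. int (c i) *s h i) = (\<Sum>i\<in>S. real (c i) *\<^sub>R real_vec (h i))"
  by (simp add: vec_eq_iff)

text \<open>One copy of a generator \<open>g\<close> that occurs in the sum is split off;
  irreducibility makes the rest 0, so the atom is \<open>g\<close>.\<close>

lemma atom_in_generators:
  assumes h: "h \<in> atoms" and H: "finite H" "H \<subseteq> cone_points"
    and sum: "h = (\<Sum>g\<in>H. int (c g) *s g)"
  shows "h \<in> H"
proof -
  obtain g where g: "g \<in> H" "int (c g) *s g \<noteq> 0"
    using sum h zero_notin_atoms by (metis (no_types, lifting) sum.neutral)
  then have "c g \<noteq> 0" "g \<noteq> 0"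
    by auto
  define v where "v = int (c g - 1) *s g + (\<Sum>k\<in>H - {g}. int (c k) *s k)"
  have "int (c g) *s g = g + int (c g - 1) *s g"
    using \<open>c g \<noteq> 0\<close> by (simp add: vec_eq_iff of_nat_diff algebra_simps)
  then have "h = g + v"
    unfolding v_def using sum sum.remove[OF H(1) g(1), of "\<lambda>k. int (c k) *s k"]
    by (simp only: add.assoc)
  moreover have "v \<in> cone_points"
    unfolding v_def using H(2) g(1)
    by (intro cone_points_add cone_points_sum cone_points_smult) auto
  ultimately have "v = 0"
    using atomD[OF h] g(1) H(2) \<open>g \<noteq> 0\<close> by blast
  then show ?thesis
    using \<open>h = g + v\<close> g(1) by simp
qed

text \<open>The atoms generate and lie in every finite generating set. They form the least one,
  which settles existence and uniqueness for the description in
  \<open>hilbert_basis\<close>.\<close>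

lemma hilbert_basis_matrix_cone: "hilbert_basis (matrix_cone A) = real_vec ` atoms"
proof -
  have inj: "inj_on real_vec S" for S :: "(int^'n) set"
    by (auto intro: inj_onI)
  have gen: "finite_generating_set (matrix_cone A) (real_vec ` atoms)"
    unfolding finite_generating_set_def matrix_cone_integer_points
  proof (intro conjI ballI)
    fix x :: "real^'n" assume "x \<in> real_vec ` cone_points"
    then obtain y where y: "y \<in> cone_points" "x = real_vec y"
      by blast
    obtain c :: "int^'n \<Rightarrow> nat" where "y = (\<Sum>h\<in>atoms. int (c h) *s h)"
      using atom_combination[OF y(1)] by blast
    then have "x = (\<Sum>h\<in>real_vec ` atoms. real (c (inv real_vec h)) *\<^sub>R h)"
      using y(2) inj by (simp add: sum.reindex real_vec_combination inv_f_f)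
    then show "\<exists>c :: real^'n \<Rightarrow> nat. x = (\<Sum>h\<in>real_vec ` atoms. real (c h) *\<^sub>R h)"
      by (intro exI[of _ "\<lambda>h. c (inv real_vec h)"])
  qed (use finite_atoms atoms_cone in auto)
  have least: "real_vec ` atoms \<subseteq> H" if H: "finite_generating_set (matrix_cone A) H" for H
  proof
    fix x assume "x \<in> real_vec ` atoms"
    then obtain h where h: "h \<in> atoms" "x = real_vec h"
      by blast
    have "H \<subseteq> real_vec ` cone_points" "finite H"
      using H by (auto simp: finite_generating_set_def matrix_cone_integer_points)
    then obtain H0 where H0: "H0 \<subseteq> cone_points" "H = real_vec ` H0"
      by (auto simp: subset_image_iff)
    then have "finite H0"
      using \<open>finite H\<close> finite_imageD inj by blast
    have "x \<in> matrix_cone A \<inter> integer_points"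
      unfolding matrix_cone_integer_points using h atoms_cone by blast
    then obtain c :: "real^'n \<Rightarrow> nat" where "x = (\<Sum>g\<in>H. real (c g) *\<^sub>R g)"
      using H unfolding finite_generating_set_def by blast
    then have "real_vec h = real_vec (\<Sum>g\<in>H0. int (c (real_vec g)) *s g)"
      using inj by (simp add: H0(2) h(2) sum.reindex real_vec_combination)
    then have "h = (\<Sum>g\<in>H0. int (c (real_vec g)) *s g)"
      by (simp only: real_vec_inject)
    then have "h \<in> H0"
      by (rule atom_in_generators[OF h(1) \<open>finite H0\<close> H0(1)])
    then show "x \<in> H"
      using h(2) H0(2) by blast
  qed
  show ?thesis
    unfolding hilbert_basis_def using gen least by (intro the_equality) blast+
qed

section \<open>The integer Caratheodory rank\<close>

definition representable :: "nat \<Rightarrow> real^'n \<Rightarrow> bool" where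
  "representable l x \<longleftrightarrow> (\<exists>(h :: nat \<Rightarrow> real^'n) (c :: nat \<Rightarrow> nat).
     (\<forall>i<l. h i \<in> hilbert_basis (matrix_cone A)) \<and> x = (\<Sum>i<l. real (c i) *\<^sub>R h i))"

lemma carath_length_eq: "carath_length (matrix_cone A) x = (LEAST l. representable l x)"
  by (simp add: carath_length_def representable_def)

lemma representable_short_sum:
  assumes "short_sum l x"
  shows "\<exists>l'\<le>l. representable l' (real_vec x)"
proof -
  obtain l' h c where *: "l' \<le> l" "\<forall>i<l'. h i \<in> atoms" "x = (\<Sum>i<l'. int (c i) *s h i)"
    using short_sum_indexed[OF assms] by blast
  then have "representable l' (real_vec x)"
    unfolding representable_def hilbert_basis_matrix_cone
    by (intro exI[of _ "\<lambda>i. real_vec (h i)"] exI[of _ c]) (simp add: real_vec_combination)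
  then show ?thesis
    using *(1) by blast
qed

lemma representableD:
  assumes "representable l (real_vec x)"
  shows "\<exists>h c. (\<forall>i<l. h i \<in> atoms) \<and> x = (\<Sum>i<l. int (c i) *s h i)"
proof -
  obtain g c where g: "\<forall>i<l. g i \<in> real_vec ` atoms" "real_vec x = (\<Sum>i<l. real (c i) *\<^sub>R g i)"
    using assms unfolding representable_def hilbert_basis_matrix_cone by blast
  then have "\<forall>i. \<exists>h. i < l \<longrightarrow> h \<in> atoms \<and> g i = real_vec h"
    by blast
  then obtain h where h: "\<And>i. i < l \<Longrightarrow> h i \<in> atoms \<and> g i = real_vec (h i)"
    by metis
  then have "real_vec x = real_vec (\<Sum>i<l. int (c i) *s h i)"
    by (simp add: g(2) real_vec_combination)
  then show ?thesis
    using h by (intro exI[of _ h] exI[of _ c]) (simp only: real_vec_inject, simp)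
qed

lemma carath_length_le: "short_sum l x \<Longrightarrow> carath_length (matrix_cone A) (real_vec x) \<le> l"
  using representable_short_sum unfolding carath_length_eq by (meson Least_le le_trans)

text \<open>The common upper bound makes the set of lengths finite, as \<open>Max\<close> requires.
  The generic point bounds its own length from below because the least length is attained.\<close>

lemma carath_rank_bounds:
  defines "D \<equiv> nat \<bar>det A\<bar>"
  shows "CARD('n) \<le> carath_rank (matrix_cone A)"
    and "carath_rank (matrix_cone A) \<le> CARD('n) + (if D \<le> 4 then 0 else D - 3)"
proof -
  let ?L = "carath_length (matrix_cone A) ` real_vec ` cone_points"
  let ?B = "CARD('n) + (if D \<le> 4 then 0 else D - 3)"
  have short: "short_sum ?B x" if "x \<in> cone_points" for x
    using short_sum_cone_face[of x UNIV] that by (simp only: D_def face_points_UNIV)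
  then have bound: "l \<le> ?B" if "l \<in> ?L" for l
    using that carath_length_le by blast
  then have fin: "finite ?L"
    by (meson finite_atMost finite_subset subsetI atMost_iff)
  have rank: "carath_rank (matrix_cone A) = Max ?L"
    by (simp only: carath_rank_def matrix_cone_integer_points)
  have "?L \<noteq> {}"
    using cone_points_0 by blast
  then show "carath_rank (matrix_cone A) \<le> ?B"
    unfolding rank using bound fin by (intro Max.boundedI) auto
  obtain x where x: "x \<in> cone_points"
    "\<And>l h c. (\<forall>i<l. h i \<in> atoms) \<Longrightarrow> x = (\<Sum>i<l. int (c i) *s h i) \<Longrightarrow> CARD('n) \<le> l"
    using long_cone_point by blast
  obtain l where "representable l (real_vec x)"
    using representable_short_sum[OF short[OF x(1)]] by blast
  then have "representable (carath_length (matrix_cone A) (real_vec x)) (real_vec x)"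
    unfolding carath_length_eq by (rule LeastI)
  then have "CARD('n) \<le> carath_length (matrix_cone A) (real_vec x)"
    using representableD x(2) by metis
  also have "\<dots> \<le> Max ?L"
    using fin x(1) by (intro Max_ge) auto
  finally show "CARD('n) \<le> carath_rank (matrix_cone A)"
    by (simp only: rank)
qed

end

theorem theorem4:
  fixes A :: "int^'n^'n"
  assumes "det A \<noteq> 0"
  shows "(1 \<le> Delta A \<and> Delta A \<le> 4 \<longrightarrow> carath_rank (matrix_cone A) = CARD('n)) \<and>
         (5 \<le> Delta A \<longrightarrow> int (carath_rank (matrix_cone A)) \<le> int CARD('n) + Delta A - 3)"
proof -
  interpret nonsingular_matrix A
    by unfold_locales (rule assms)
  \<comment> \<open>For \<open>Delta A\<close> at least 5 the truncated subtraction in the bound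
    agrees with integer subtraction; up to 4 the two bounds coincide.\<close>
  show ?thesis
    using carath_rank_bounds unfolding Delta_def
    by (auto split: if_splits)
qed

end
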